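(* Let $m\ge 3$ be an integer. Then every integer $N\ge 1056m^3$ can be written as $p_{m+2}(x_1)+p_{m+2}(x_2)+2p_{m+2}(x_3)+4p_{m+2}(x_4)$ with $x_1,x_2,x_3,x_4\in\mathbb{N}$.
   Context: $\mathbb{N}=\{0,1,2,\dots\}$. For integers $m\ge1$ and $n$, $p_{m+2}(n)=m\binom n2+n=\frac{mn^2-(m-2)n}{2}$. *)

theory Defs
  imports Complex_Main
begin

text \<open>The \<open>n\<close>-th \<open>s\<close>-gonal number \<open>p\<^sub>s(n) = (s - 2) binom(n, 2) + n\<close>.
  The argument \<open>n\<close> may be any integer, so the binomial coefficient is written as
  \<open>n(n - 1) / 2\<close>; the division is exact.\<close>

definition polygonal :: "int \<Rightarrow> int \<Rightarrow> int" where
  "polygonal s n = (s - 2) * (n * (n - 1) div 2) + n"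

lemma polygonal_of_nat:
  "polygonal (m + 2) (int k) = m * int (k choose 2) + int k"
proof -
  have "int (k * (k - 1)) = int k * (int k - 1)"
    by (cases k) (auto simp: algebra_simps)
  then have "int (k choose 2) = int k * (int k - 1) div 2"
    by (simp only: choose_two zdiv_int of_nat_numeral)
  then show ?thesis
    by (simp add: polygonal_def)
qed

lemma polygonal_closed_form:
  "polygonal (m + 2) n = (m * n\<^sup>2 - (m - 2) * n) div 2"
proof -
  have half: "2 * (n * (n - 1) div 2) = n * (n - 1)"
    by (rule dvd_mult_div_cancel) auto
  have "2 * polygonal (m + 2) n = m * (2 * (n * (n - 1) div 2)) + 2 * n"
    by (simp add: polygonal_def)
  also have "\<dots> = m * n\<^sup>2 - (m - 2) * n"
    unfolding half by (simp add: algebra_simps power2_eq_square)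
  finally show ?thesis by linarith
qed

end

theory Submission
  imports Defs "HOL-Number_Theory.Number_Theory" "HOL-Computational_Algebra.Squarefree"
begin

text \<open>Write \<open>N = mk + b\<close> and \<open>a = b + 2k\<close>. Representing \<open>N\<close> amounts to finding natural numbers with
  \<open>x1 + x2 + 2 x3 + 4 x4 = b\<close> and \<open>x1\<^sup>2 + x2\<^sup>2 + 2 x3\<^sup>2 + 4 x4\<^sup>2 = a\<close>. As in Cauchy's lemma, integer
  solutions correspond to representations \<open>8a - b\<^sup>2 = w\<^sup>2 + 2v\<^sup>2 + 4u\<^sup>2\<close> satisfying congruences, and
  \<open>7a < b\<^sup>2 + 2b + 8\<close> forces them to be nonnegative. The bound on \<open>N\<close> lets \<open>k\<close> be chosen in any
  residue class modulo 8, so that the ternary representation reduces to one of an odd number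
  as \<open>x\<^sup>2 + y\<^sup>2 + 2z\<^sup>2\<close>, that is, to twice an odd number \<open>n\<close> being a sum of three squares.

  For the latter, Dirichlet's argument builds an integral ternary form of determinant 1
  representing \<open>2n\<close> from a prime \<open>p \<equiv> -1\<close> modulo \<open>2n\<close> for which \<open>-2n\<close> is a quadratic residue.
  Primes in arithmetic progressions can be avoided: it is enough to have \<open>M = m f\<^sup>2 \<equiv> -1\<close> such that
  \<open>-2n\<close> is a square modulo \<open>m\<close>, and this holds as soon as \<open>\<Sum>d | d dvd M. \<chi> d \<noteq> 0\<close> for the quadratic
  character \<open>\<chi>\<close> of discriminant \<open>-8n\<close>. Such an \<open>M\<close> exists because these divisor sums, weighted by
  \<open>1 / sqrt M\<close>, differ by a bounded amount between the residue class wanted and that of 1,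
  where the squares alone contribute a divergent series.\<close>

section \<open>Ternary forms of determinant 1\<close>

lemma nearest_multiple:
  fixes a x :: int
  assumes "a > 0"
  shows "\<exists>k. 2 * \<bar>x + k * a\<bar> \<le> a"
proof -
  define k where "k = - ((2 * x + a) div (2 * a))"
  have "(2 * x + a) = (2 * a) * ((2 * x + a) div (2 * a)) + (2 * x + a) mod (2 * a)"
    by simp
  moreover have "0 \<le> (2 * x + a) mod (2 * a)" "(2 * x + a) mod (2 * a) < 2 * a"
    using assms by simp_all
  ultimately have "2 * (x + k * a) \<le> a" "- a \<le> 2 * (x + k * a)"
    unfolding k_def by (simp_all add: algebra_simps)
  then have "2 * \<bar>x + k * a\<bar> \<le> a" by linarith
  then show ?thesis ..
qed

text \<open>Gauss reduction: a shift makes the middle coefficient at most half the leading one, and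
  a smaller last coefficient is then swapped to the front. Coprimality is kept so that
  \<open>(p, r)\<close> can later be completed to a unimodular matrix.\<close>

lemma binary_form_small_value:
  fixes A B C D :: int
  assumes "A > 0" "A * C - B\<^sup>2 = D" "D > 0"
  shows "\<exists>p r. coprime p r \<and> 3 * (A * p\<^sup>2 + 2 * B * p * r + C * r\<^sup>2)\<^sup>2 \<le> 4 * D"
  using assms(1,2)
proof (induction "nat A" arbitrary: A B C rule: less_induct)
  case less
  obtain k where k: "2 * \<bar>B + k * A\<bar> \<le> A"
    using nearest_multiple[OF less.prems(1)] by blast
  define B' where "B' = B + k * A"
  define C' where "C' = C + 2 * k * B + k\<^sup>2 * A"
  have det: "A * C' - B'\<^sup>2 = D"
    using less.prems(2) unfolding B'_def C'_def by (simp add: algebra_simps power2_eq_square)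
  have B'sq: "4 * B'\<^sup>2 \<le> A\<^sup>2"
    using power_mono[OF k, of 2] unfolding B'_def by (simp add: power_mult_distrib)
  show ?case
  proof (cases "C' < A")
    \<comment> \<open>Reduced case: A^2 <= A C' = D + B'^2 <= D + A^2 / 4, and \<open>A\<close> is
      the value at (1, 0).\<close>
    case False
    then have "A\<^sup>2 \<le> A * C'"
      using less.prems(1) by (simp add: power2_eq_square)
    then have "3 * A\<^sup>2 \<le> 4 * D"
      using det B'sq by linarith
    then show ?thesis
      by (intro exI[of _ 1] exI[of _ 0]) simp
  next
    case True
    have "A * C' > 0"
      using det \<open>D > 0\<close> zero_le_power2[of B'] by linarith
    then have "C' > 0"
      using less.prems(1) by (simp add: zero_less_mult_iff)
    with True less.prems(1) have "nat C' < nat A" by simp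
    moreover have "C' * A - (- B')\<^sup>2 = D"
      using det by (simp add: mult.commute)
    ultimately obtain p r where pr: "coprime p r"
      "3 * (C' * p\<^sup>2 + 2 * (- B') * p * r + A * r\<^sup>2)\<^sup>2 \<le> 4 * D"
      using less.hyps[of C' A "- B'"] \<open>C' > 0\<close> by blast
    \<comment> \<open>Undoing the swap and the shift sends \<open>(p, r)\<close> to
      \<open>(k * p - r, p)\<close>.\<close>
    have "coprime (k * p - r) p"
      using pr(1) by (metis coprime_commute coprime_minus_right_iff diff_conv_add_uminus add.commute coprime_iff_gcd_eq_1 gcd_add_mult mult.commute)
    moreover have "A * (k * p - r)\<^sup>2 + 2 * B * (k * p - r) * p + C * p\<^sup>2
        = C' * p\<^sup>2 + 2 * (- B') * p * r + A * r\<^sup>2"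
      unfolding B'_def C'_def by (simp add: algebra_simps power2_eq_square)
    ultimately show ?thesis
      using pr(2) by metis
  qed
qed

text \<open>Even cross terms make the Gram matrix with rows (a, d, e), (d, b, f), (e, f, c)
  integral; \<open>ternary_det\<close> is its determinant.\<close>

definition ternary_form :: "int \<Rightarrow> int \<Rightarrow> int \<Rightarrow> int \<Rightarrow> int \<Rightarrow> int \<Rightarrow> int \<Rightarrow> int \<Rightarrow> int \<Rightarrow> int" where
  "ternary_form a b c d e f x y z =
     a * x\<^sup>2 + b * y\<^sup>2 + c * z\<^sup>2 + 2 * d * x * y + 2 * e * x * z + 2 * f * y * z"

definition ternary_det :: "int \<Rightarrow> int \<Rightarrow> int \<Rightarrow> int \<Rightarrow> int \<Rightarrow> int \<Rightarrow> int" where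
  "ternary_det a b c d e f = a * b * c + 2 * d * e * f - a * f\<^sup>2 - b * e\<^sup>2 - c * d\<^sup>2"

text \<open>Reduction by induction on the leading coefficient: while it exceeds 1, a unimodular
  change of variables produces a smaller positive diagonal coefficient to take its place; once it is
  1, completing squares gives the identity form.\<close>

lemma ternary_form_sum_of_three_squares:
  assumes "a > 0" "a * b - d\<^sup>2 > 0" "ternary_det a b c d e f = 1"
  shows "\<exists>r s t. ternary_form a b c d e f x y z = r\<^sup>2 + s\<^sup>2 + t\<^sup>2"
  using assms
proof (induction "nat a" arbitrary: a b c d e f x y z rule: less_induct)
  case less
  \<comment> \<open>\<open>a\<close> times the form is (a x + d y + e z)^2 + A y^2 + 2 B y z + C
    z^2, and this binary remainder has determinant \<open>a\<close>.\<close>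
  define A where "A = a * b - d\<^sup>2"
  define B where "B = a * f - d * e"
  define C where "C = a * c - e\<^sup>2"
  have "A > 0" using less.prems(2) by (simp add: A_def)
  have "A * C - B\<^sup>2 = a * ternary_det a b c d e f"
    unfolding A_def B_def C_def ternary_det_def by (simp add: algebra_simps power2_eq_square)
  then have ABC: "A * C - B\<^sup>2 = a" using less.prems(3) by simp
  obtain p r where pr: "coprime p r" "3 * (A * p\<^sup>2 + 2 * B * p * r + C * r\<^sup>2)\<^sup>2 \<le> 4 * a"
    using binary_form_small_value[OF \<open>A > 0\<close> ABC less.prems(1)] by blast
  define A' where "A' = A * p\<^sup>2 + 2 * B * p * r + C * r\<^sup>2"
  have "A * A' = (A * p + B * r)\<^sup>2 + (A * C - B\<^sup>2) * r\<^sup>2"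
    unfolding A'_def by (simp add: algebra_simps power2_eq_square)
  then have AA': "A * A' = (A * p + B * r)\<^sup>2 + a * r\<^sup>2" using ABC by simp
  have "A * A' > 0"
  proof (cases "r = 0")
    case True
    then have "p \<noteq> 0" using pr(1) by auto
    then show ?thesis using AA' True \<open>A > 0\<close> by simp
  next
    case False
    then have "a * r\<^sup>2 > 0" using less.prems(1) by simp
    then show ?thesis unfolding AA' using zero_le_power2[of "A * p + B * r"] by linarith
  qed
  then have "A' > 0" using \<open>A > 0\<close> by (simp add: zero_less_mult_iff)
  obtain s q' where "s * p + q' * r = 1"
    using bezout_int[of p r] pr(1) by auto
  then obtain q where unimod: "p * s - q * r = 1"
    by (metis diff_minus_eq_add mult.commute mult_minus_left)
  \<comment> \<open>Coefficients after y = p Y + q Z, z = r Y + s Z, which turns the leading minor a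
    b - d^2 into \<open>A'\<close>. The shift by \<open>k\<close> below makes \<open>d2\<close>
    small and keeps this minor.\<close>
  define b1 where "b1 = b * p\<^sup>2 + 2 * f * p * r + c * r\<^sup>2"
  define c1 where "c1 = b * q\<^sup>2 + 2 * f * q * s + c * s\<^sup>2"
  define d1 where "d1 = d * p + e * r"
  define e1 where "e1 = d * q + e * s"
  define f1 where "f1 = b * p * q + f * (p * s + q * r) + c * r * s"
  obtain k where k: "2 * \<bar>d1 + k * a\<bar> \<le> a"
    using nearest_multiple[OF less.prems(1)] by blast
  define b2 where "b2 = b1 + 2 * k * d1 + k\<^sup>2 * a"
  define d2 where "d2 = d1 + k * a"
  define f2 where "f2 = f1 + k * e1"
  have minor: "a * b2 - d2\<^sup>2 = A'"
    unfolding b2_def d2_def b1_def d1_def A'_def A_def B_def C_def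
    by (simp add: algebra_simps power2_eq_square)
  have "ternary_det a b2 c1 d2 e1 f2 = ternary_det a b c d e f * (p * s - q * r)\<^sup>2"
    unfolding ternary_det_def b2_def d2_def f2_def b1_def c1_def d1_def e1_def f1_def
    by (simp add: algebra_simps power2_eq_square)
  then have det: "ternary_det a b2 c1 d2 e1 f2 = 1"
    using less.prems(3) unimod by simp
  define Y where "Y = s * y - q * z"
  define Z where "Z = p * z - r * y"
  define X where "X = x - k * Y"
  have "y = (p * s - q * r) * y" "z = (p * s - q * r) * z"
    by (simp_all add: unimod)
  then have xyz: "x = X + k * Y" "y = p * Y + q * Z" "z = r * Y + s * Z"
    unfolding X_def Y_def Z_def by (simp_all add: algebra_simps)
  have form: "ternary_form a b c d e f x y z = ternary_form a b2 c1 d2 e1 f2 X Y Z"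
    unfolding xyz ternary_form_def b2_def d2_def f2_def b1_def c1_def d1_def e1_def f1_def
    by (simp add: algebra_simps power2_eq_square)
  have d2sq: "4 * d2\<^sup>2 \<le> a\<^sup>2"
    using power_mono[OF k, of 2] unfolding d2_def by (simp add: power_mult_distrib)
  have A'sq: "3 * A'\<^sup>2 \<le> 4 * a" using pr(2) by (simp add: A'_def)
  show ?case
  proof (cases "a = 1")
    case True
    then have "2 * \<bar>d2\<bar> \<le> 1" using k by (simp add: d2_def)
    then have "d2 = 0" by linarith
    have "A' < 2"
    proof (rule ccontr)
      assume "\<not> A' < 2"
      then have "2\<^sup>2 \<le> A'\<^sup>2" by (intro power_mono) auto
      then show False using A'sq True by simp
    qed
    then have "b2 = 1" using minor True \<open>d2 = 0\<close> \<open>A' > 0\<close> by simp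
    have "c1 = 1 + e1\<^sup>2 + f2\<^sup>2"
      using det True \<open>d2 = 0\<close> \<open>b2 = 1\<close> by (simp add: ternary_det_def)
    then have "ternary_form a b2 c1 d2 e1 f2 X Y Z = (X + e1 * Z)\<^sup>2 + (Y + f2 * Z)\<^sup>2 + Z\<^sup>2"
      using True \<open>d2 = 0\<close> \<open>b2 = 1\<close>
      by (simp add: ternary_form_def algebra_simps power2_eq_square)
    then show ?thesis using form by metis
  next
    case False
    then have "a \<ge> 2" using less.prems(1) by simp
    have "a * b2 > 0" using minor \<open>A' > 0\<close> zero_le_power2[of d2] by linarith
    then have "b2 > 0" using less.prems(1) by (simp add: zero_less_mult_iff)
    \<comment> \<open>Together with d2^2 <= a^2 / 4 this gives a b2 = A' + d2^2 < a^2. Its negation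
      and 3 A'^2 <= 4 a would force 27 a^3 <= 64, impossible for a >= 2.\<close>
    have "4 * A' < 3 * a\<^sup>2"
    proof (rule ccontr)
      assume "\<not> 4 * A' < 3 * a\<^sup>2"
      then have "(3 * a\<^sup>2)\<^sup>2 \<le> (4 * A')\<^sup>2" by (intro power_mono) auto
      then have "27 * (a\<^sup>2)\<^sup>2 \<le> 16 * (3 * A'\<^sup>2)" by (simp add: power_mult_distrib)
      then have "27 * (a\<^sup>2)\<^sup>2 \<le> 64 * a" using A'sq by linarith
      then have "27 * a ^ 3 * a \<le> 64 * a" by (simp add: power2_eq_square power3_eq_cube mult_ac)
      then have "27 * a ^ 3 \<le> 64" using less.prems(1) by simp
      moreover have "2 ^ 3 \<le> a ^ 3" using \<open>a \<ge> 2\<close> by (intro power_mono) auto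
      ultimately show False by simp
    qed
    then have "a * b2 < a * a" using minor d2sq by (simp add: power2_eq_square)
    then have "b2 < a" using less.prems(1) by simp
    then have "nat b2 < nat a" using \<open>b2 > 0\<close> by simp
    moreover have "b2 * a - d2\<^sup>2 > 0" using minor \<open>A' > 0\<close> by (simp add: mult.commute)
    moreover have "ternary_det b2 a c1 d2 f2 e1 = 1"
      using det by (simp add: ternary_det_def algebra_simps)
    ultimately obtain r s t where
      "ternary_form b2 a c1 d2 f2 e1 Y X Z = r\<^sup>2 + s\<^sup>2 + t\<^sup>2"
      using less.hyps[of b2 a d2 c1 f2 e1 Y X Z] \<open>b2 > 0\<close> by blast
    moreover have "ternary_form b2 a c1 d2 f2 e1 Y X Z = ternary_form a b2 c1 d2 e1 f2 X Y Z"
      by (simp add: ternary_form_def algebra_simps)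
    ultimately show ?thesis using form by metis
  qed
qed

section \<open>Sums over the hyperbola\<close>

lemma periodic_sum_bound:
  fixes g :: "nat \<Rightarrow> real"
  assumes "P > 0" and period: "\<And>n. g (n + P) = g n" and mean: "(\<Sum>n<P. g n) = 0"
    and bound: "\<And>n. \<bar>g n\<bar> \<le> C"
  shows "\<bar>\<Sum>n<j. g n\<bar> \<le> C * P"
proof (induction j rule: less_induct)
  case (less j)
  have "C \<ge> 0" using bound[of 0] by linarith
  show ?case
  proof (cases "j < P")
    case True
    have "\<bar>\<Sum>n<j. g n\<bar> \<le> (\<Sum>n<j. C)"
      using bound by (intro order_trans[OF sum_abs sum_mono])
    also have "\<dots> \<le> C * P"
      using True \<open>C \<ge> 0\<close> by (simp add: mult.commute mult_left_mono)
    finally show ?thesis .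
  next
    case False
    \<comment> \<open>A complete period is split off; its sum is zero, so the induction passes to
      \<open>i\<close>.\<close>
    then obtain i where i: "j = P + i" using le_Suc_ex not_less by blast
    have "(\<Sum>n<j. g n) = (\<Sum>n<P. g n) + (\<Sum>n<i. g (n + P))"
      unfolding i by (induction i) (auto simp: add.commute)
    then have "(\<Sum>n<j. g n) = (\<Sum>n<i. g n)" using mean period by simp
    then show ?thesis using less.IH[of i] i \<open>P > 0\<close> by simp
  qed
qed

lemma periodic_interval_sum_bound:
  fixes g :: "nat \<Rightarrow> real"
  assumes "P > 0" and "\<And>n. g (n + P) = g n" and "(\<Sum>n<P. g n) = 0"
    and "\<And>n. \<bar>g n\<bar> \<le> C"
  shows "\<bar>\<Sum>n\<in>{a..<b}. g n\<bar> \<le> 2 * C * P"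
proof (cases "a \<le> b")
  case True
  then have "(\<Sum>n\<in>{a..<b}. g n) = (\<Sum>n<b. g n) - (\<Sum>n<a. g n)"
    by (simp add: lessThan_atLeast0 sum_diff_nat_ivl)
  then show ?thesis
    using periodic_sum_bound[OF assms, of a] periodic_sum_bound[OF assms, of b] by linarith
next
  case False
  have "C \<ge> 0" using assms(4)[of 0] by linarith
  then show ?thesis using False by simp
qed

text \<open>Summation by parts: the partial sums of \<open>g\<close> are at most \<open>K\<close>,
  and the decrements of the weights telescope, with the boundary term, to
  \<open>w a\<close>.\<close>

lemma abel_summation_bound:
  fixes g w :: "nat \<Rightarrow> real"
  assumes bound: "\<And>b. \<bar>\<Sum>n\<in>{a..<b}. g n\<bar> \<le> K"
    and nonneg: "\<And>n. n \<ge> a \<Longrightarrow> w n \<ge> 0"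
    and decr: "\<And>n. n \<ge> a \<Longrightarrow> w (Suc n) \<le> w n"
  shows "\<bar>\<Sum>n\<in>{a..<b}. g n * w n\<bar> \<le> K * w a"
proof (cases "a \<le> b")
  case True
  define S where "S b = (\<Sum>n\<in>{a..<b}. g n)" for b
  have S_bound: "\<bar>S b\<bar> \<le> K" for b using bound by (simp add: S_def)
  have eq: "(\<Sum>n\<in>{a..<b}. g n * w n) = S b * w b + (\<Sum>n\<in>{a..<b}. S (Suc n) * (w n - w (Suc n)))"
    using True
  proof (induction b rule: dec_induct)
    case base
    then show ?case by (simp add: S_def)
  next
    case (step b)
    have "S (Suc b) = S b + g b" using step.hyps by (simp add: S_def)
    then show ?case using step by (simp add: algebra_simps)
  qed
  have tele: "(\<Sum>n\<in>{a..<b}. w n - w (Suc n)) = w a - w b"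
    using True by (induction b rule: dec_induct) auto
  have "\<bar>\<Sum>n\<in>{a..<b}. S (Suc n) * (w n - w (Suc n))\<bar>
      \<le> (\<Sum>n\<in>{a..<b}. K * (w n - w (Suc n)))"
    using S_bound decr by (intro order_trans[OF sum_abs sum_mono])
      (auto simp: abs_mult intro!: mult_right_mono)
  also have "\<dots> = K * (w a - w b)" by (simp add: sum_distrib_left[symmetric] tele)
  finally have "\<bar>\<Sum>n\<in>{a..<b}. S (Suc n) * (w n - w (Suc n))\<bar> \<le> K * (w a - w b)" .
  moreover have "\<bar>S b * w b\<bar> \<le> K * w b"
    using S_bound nonneg[OF True] by (auto simp: abs_mult intro!: mult_right_mono)
  ultimately have "\<bar>\<Sum>n\<in>{a..<b}. g n * w n\<bar> \<le> K * w b + K * (w a - w b)"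
    unfolding eq by linarith
  then show ?thesis by (simp add: algebra_simps)
next
  case False
  have "K \<ge> 0" using bound[of a] by simp
  then show ?thesis using False nonneg[of a] by simp
qed

lemma periodic_sum_sqrt_bound:
  fixes g :: "nat \<Rightarrow> real"
  assumes "P > 0" and "\<And>n. g (n + P) = g n" and "(\<Sum>n<P. g n) = 0"
    and "\<And>n. \<bar>g n\<bar> \<le> C" and "a > 0"
  shows "\<bar>\<Sum>n\<in>{a..b}. g n / sqrt n\<bar> \<le> 2 * C * P / sqrt a"
proof -
  have "\<bar>\<Sum>n\<in>{a..<Suc b}. g n * (1 / sqrt n)\<bar> \<le> 2 * C * P * (1 / sqrt a)"
    using periodic_interval_sum_bound[OF assms(1-4)] \<open>a > 0\<close>
    by (intro abel_summation_bound) (auto intro!: divide_left_mono)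
  then show ?thesis by (simp add: atLeastLessThanSuc_atLeastAtMost)
qed

lemma sum_inverse_sqrt_le: "(\<Sum>n\<in>{1..s}. 1 / sqrt (real n)) \<le> 2 * sqrt s"
proof (induction s)
  case (Suc s)
  have "1 / sqrt (Suc s) \<le> 2 * (sqrt (Suc s) - sqrt s)"
  proof -
    have "(sqrt (Suc s) - sqrt s) * (sqrt (Suc s) + sqrt s) = 1"
      by (simp add: algebra_simps)
    moreover have "sqrt (Suc s) + sqrt s \<le> 2 * sqrt (Suc s)" by simp
    moreover have "sqrt (Suc s) - sqrt s \<ge> 0" by simp
    ultimately have "1 \<le> (sqrt (Suc s) - sqrt s) * (2 * sqrt (Suc s))"
      using mult_left_mono[of "sqrt s + sqrt (Suc s)" "2 * sqrt (Suc s)" "sqrt (Suc s) - sqrt s"]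
      by (simp add: add.commute)
    then show ?thesis by (simp add: field_simps)
  qed
  then show ?case using Suc by simp
qed simp

section \<open>Dirichlet's hyperbola method\<close>

definition hyperbola_region :: "nat \<Rightarrow> (nat \<times> nat) set" where
  "hyperbola_region x = {(d, e). 1 \<le> d \<and> 1 \<le> e \<and> d * e \<le> x}"

text \<open>No point of the region has both coordinates above \<open>s\<close>, so it consists of a
  square and two mirror-image tails; the cutoff s^2 lets the whole square fit.\<close>

lemma hyperbola_region_split:
  fixes F :: "nat \<Rightarrow> nat \<Rightarrow> real"
  shows "(\<Sum>(d, e)\<in>hyperbola_region (s\<^sup>2). F d e) =
     (\<Sum>d\<in>{1..s}. \<Sum>e\<in>{1..s}. F d e) +
     (\<Sum>d\<in>{1..s}. \<Sum>e\<in>{Suc s..s\<^sup>2 div d}. F d e) +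
     (\<Sum>e\<in>{1..s}. \<Sum>d\<in>{Suc s..s\<^sup>2 div e}. F d e)"
proof -
  let ?A = "{1..s} \<times> {1..s}"
  let ?B = "SIGMA d:{1..s}. {Suc s..s\<^sup>2 div d}"
  let ?C = "prod.swap ` ?B"
  have "hyperbola_region (s\<^sup>2) = ?A \<union> ?B \<union> ?C"
  proof (intro equalityI subsetI)
    fix z assume "z \<in> hyperbola_region (s\<^sup>2)"
    then obtain d e where z: "z = (d, e)" "1 \<le> d" "1 \<le> e" "d * e \<le> s\<^sup>2"
      by (auto simp: hyperbola_region_def)
    have "d \<le> s \<or> e \<le> s"
    proof (rule ccontr)
      assume "\<not> (d \<le> s \<or> e \<le> s)"
      then have "s * s < d * e" by (intro mult_strict_mono) auto
      then show False using z by (simp add: power2_eq_square)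
    qed
    moreover have "e \<le> s\<^sup>2 div d" "d \<le> s\<^sup>2 div e"
      using z by (simp_all add: less_eq_div_iff_mult_less_eq mult.commute)
    ultimately show "z \<in> ?A \<union> ?B \<union> ?C" using z by (auto simp: image_iff not_le)
  next
    fix z assume "z \<in> ?A \<union> ?B \<union> ?C"
    then show "z \<in> hyperbola_region (s\<^sup>2)"
    proof (elim UnE)
      assume "z \<in> ?A"
      then show ?thesis by (auto simp: hyperbola_region_def power2_eq_square intro!: mult_mono)
    next
      assume "z \<in> ?B"
      then show ?thesis
        by (auto simp: hyperbola_region_def less_eq_div_iff_mult_less_eq mult.commute)
    next
      assume "z \<in> ?C"
      then show ?thesis
        by (auto simp: hyperbola_region_def less_eq_div_iff_mult_less_eq mult.commute)
    qed
  qed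
  moreover have "?A \<inter> ?B = {}" "(?A \<union> ?B) \<inter> ?C = {}" by auto
  ultimately have "(\<Sum>(d, e)\<in>hyperbola_region (s\<^sup>2). F d e)
      = (\<Sum>(d, e)\<in>?A. F d e) + (\<Sum>(d, e)\<in>?B. F d e) + (\<Sum>(d, e)\<in>?C. F d e)"
    by (simp add: sum.union_disjoint)
  also have "(\<Sum>(d, e)\<in>?C. F d e) = (\<Sum>(e, d)\<in>?B. F d e)"
    by (subst sum.reindex) (auto simp: case_prod_beta intro!: sum.cong)
  finally show ?thesis by (simp add: sum.Sigma sum.cartesian_product)
qed

text \<open>Dirichlet's hyperbola method; the cancellation in both variables makes the main terms vanish.\<close>

lemma hyperbola_sum_bound:
  fixes f :: "nat \<Rightarrow> nat \<Rightarrow> real"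
  assumes "P > 0"
    and per1: "\<And>d e. f (d + P) e = f d e" and per2: "\<And>d e. f d (e + P) = f d e"
    and mean1: "\<And>e. (\<Sum>d<P. f d e) = 0" and mean2: "\<And>d. (\<Sum>e<P. f d e) = 0"
    and bound: "\<And>d e. \<bar>f d e\<bar> \<le> 1"
  shows "\<bar>\<Sum>(d, e)\<in>hyperbola_region (s\<^sup>2). f d e / (sqrt d * sqrt e)\<bar> \<le> 4 * real P ^ 2 + 8 * real P"
proof -
  \<comment> \<open>Tails: cancellation over e > s makes each inner sum of size P / sqrt s up to the
    factor 1 / sqrt d, and summing that factor over d <= s costs only sqrt s.\<close>
  have side: "\<bar>\<Sum>d\<in>{1..s}. \<Sum>e\<in>{Suc s..s\<^sup>2 div d}. h d e / (sqrt d * sqrt e)\<bar> \<le> 4 * real P"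
    if per: "\<And>d e. h d (e + P) = h d e" and mean: "\<And>d. (\<Sum>e<P. h d e) = 0"
      and h1: "\<And>d e. \<bar>h d e\<bar> \<le> 1" for h :: "nat \<Rightarrow> nat \<Rightarrow> real"
  proof -
    have "\<bar>\<Sum>e\<in>{Suc s..s\<^sup>2 div d}. h d e / (sqrt d * sqrt e)\<bar> \<le> 2 * P / sqrt (Suc s) * (1 / sqrt d)" for d
    proof -
      have "(\<Sum>e\<in>{Suc s..s\<^sup>2 div d}. h d e / (sqrt d * sqrt e))
          = (\<Sum>e\<in>{Suc s..s\<^sup>2 div d}. h d e / sqrt e) * (1 / sqrt d)"
        by (simp add: sum_divide_distrib mult.commute)
      then have "\<bar>\<Sum>e\<in>{Suc s..s\<^sup>2 div d}. h d e / (sqrt d * sqrt e)\<bar>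
          = \<bar>\<Sum>e\<in>{Suc s..s\<^sup>2 div d}. h d e / sqrt e\<bar> * (1 / sqrt d)"
        by (simp add: abs_mult)
      also have "\<dots> \<le> 2 * P / sqrt (Suc s) * (1 / sqrt d)"
        using periodic_sum_sqrt_bound[of P "h d" 1 "Suc s" "s\<^sup>2 div d"] \<open>P > 0\<close> per mean h1
        by (intro mult_right_mono) auto
      finally show ?thesis .
    qed
    then have "\<bar>\<Sum>d\<in>{1..s}. \<Sum>e\<in>{Suc s..s\<^sup>2 div d}. h d e / (sqrt d * sqrt e)\<bar>
        \<le> (\<Sum>d\<in>{1..s}. 2 * P / sqrt (Suc s) * (1 / sqrt d))"
      by (intro order_trans[OF sum_abs sum_mono])
    moreover have "(\<Sum>d\<in>{1..s}. 2 * P / sqrt (Suc s) * (1 / sqrt d))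
        = 2 * P / sqrt (Suc s) * (\<Sum>d\<in>{1..s}. 1 / sqrt d)"
      by (simp only: sum_distrib_left)
    moreover have "2 * P / sqrt (Suc s) * (\<Sum>d\<in>{1..s}. 1 / sqrt d) \<le> 2 * P / sqrt (Suc s) * (2 * sqrt s)"
      using sum_inverse_sqrt_le by (intro mult_left_mono) auto
    moreover have "2 * P / sqrt (Suc s) * (2 * sqrt s) = 4 * real P * (sqrt s / sqrt (Suc s))" by simp
    moreover have "4 * real P * (sqrt s / sqrt (Suc s)) \<le> 4 * real P * 1"
      by (intro mult_left_mono) auto
    ultimately show ?thesis by linarith
  qed
  have square: "\<bar>\<Sum>d\<in>{1..s}. \<Sum>e\<in>{1..s}. f d e / (sqrt d * sqrt e)\<bar> \<le> 4 * real P ^ 2"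
  proof -
    \<comment> \<open>On the square, cancellation is used twice: in \<open>d\<close> it bounds
      \<open>G\<close>, which is itself periodic with mean zero in \<open>e\<close>.\<close>
    define G where "G e = (\<Sum>d\<in>{1..s}. f d e / sqrt d)" for e
    have "(\<Sum>e<P. G e) = (\<Sum>d\<in>{1..s}. (\<Sum>e<P. f d e) / sqrt d)"
      unfolding G_def by (subst sum.swap) (simp add: sum_divide_distrib)
    then have "(\<Sum>e<P. G e) = 0" by (simp add: mean2)
    moreover have "\<bar>G e\<bar> \<le> 2 * real P" for e
      using periodic_sum_sqrt_bound[of P "\<lambda>d. f d e" 1 1 s] \<open>P > 0\<close> per1 mean1 bound
      by (simp add: G_def)
    moreover have "G (e + P) = G e" for e by (simp add: G_def per2)
    ultimately have "\<bar>\<Sum>e\<in>{1..s}. G e / sqrt e\<bar> \<le> 2 * (2 * real P) * P"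
      using periodic_sum_sqrt_bound[of P G "2 * real P" 1 s] \<open>P > 0\<close> by simp
    moreover have "(\<Sum>d\<in>{1..s}. \<Sum>e\<in>{1..s}. f d e / (sqrt d * sqrt e)) = (\<Sum>e\<in>{1..s}. G e / sqrt e)"
      unfolding G_def by (subst sum.swap) (simp add: sum_divide_distrib)
    ultimately show ?thesis by (simp add: power2_eq_square)
  qed
  have "\<bar>\<Sum>e\<in>{1..s}. \<Sum>d\<in>{Suc s..s\<^sup>2 div e}. f d e / (sqrt d * sqrt e)\<bar> \<le> 4 * real P"
    using side[of "\<lambda>e d. f d e"] per1 mean1 bound by (simp add: mult.commute)
  then show ?thesis
    unfolding hyperbola_region_split using square side[of f, OF per2 mean2 bound] by linarith
qed

lemma sum_divisors_hyperbola:
  fixes F :: "nat \<Rightarrow> nat \<Rightarrow> real"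
  shows "(\<Sum>n\<in>{1..x}. \<Sum>d | d dvd n. F d (n div d)) = (\<Sum>(d, e)\<in>hyperbola_region x. F d e)"
proof -
  have "(\<Sum>n\<in>{1..x}. \<Sum>d | d dvd n. F d (n div d))
      = (\<Sum>(n, d)\<in>(SIGMA n:{1..x}. {d. d dvd n}). F d (n div d))"
    by (intro sum.Sigma) auto
  also have "\<dots> = (\<Sum>(d, e)\<in>hyperbola_region x. F d e)"
    by (rule sum.reindex_bij_witness[of _ "\<lambda>(d, e). (d * e, d)" "\<lambda>(n, d). (d, n div d)"])
      (auto simp: hyperbola_region_def elim!: dvdE)
  finally show ?thesis .
qed

text \<open>Comparison with the logarithm: ln (t + P) - ln t <= P / t at t = 1 + j P.\<close>

lemma sum_inverse_arith_progression_ge: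
  assumes "P > 0"
  shows "(\<Sum>j<J. 1 / real (1 + j * P)) \<ge> ln (real (1 + J * P)) / P"
proof (induction J)
  case (Suc J)
  define t where "t = real (1 + J * P)"
  have "t > 0" by (simp add: t_def add_pos_nonneg)
  have "real (1 + Suc J * P) = t * (1 + P / t)"
    using \<open>t > 0\<close> by (simp add: t_def distrib_left)
  moreover have "ln (t * (1 + P / t)) = ln t + ln (1 + P / t)"
    using \<open>t > 0\<close> by (intro ln_mult_pos) (auto intro: add_pos_nonneg)
  moreover have "ln (1 + P / t) \<le> P / t"
    using \<open>t > 0\<close> by (intro ln_add_one_self_le_self) auto
  ultimately have "ln (real (1 + Suc J * P)) / P \<le> (ln t + P / t) / P"
    by (intro divide_right_mono) auto
  also have "\<dots> = ln t / P + 1 / t"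
    using assms by (simp add: add_divide_distrib)
  finally show ?case using Suc by (simp add: t_def)
qed simp

section \<open>Divisor sums of a real character\<close>

lemma prime_power_induct [consumes 1, case_names one prime_power]:
  fixes n :: nat
  assumes "n > 0" and "Q 1"
    and step: "\<And>p k m. prime p \<Longrightarrow> k > 0 \<Longrightarrow> m > 0 \<Longrightarrow> \<not> p dvd m \<Longrightarrow> Q m \<Longrightarrow> Q (p ^ k * m)"
  shows "Q n"
  using assms(1)
proof (induction n rule: less_induct)
  case (less n)
  show ?case
  proof (cases "n = 1")
    case True
    then show ?thesis using assms(2) by simp
  next
    case False
    then obtain p where p: "prime p" "p dvd n" by (metis prime_factor_nat)
    define k where "k = multiplicity p n"
    obtain m where m: "n = p ^ k * m" "\<not> p dvd m"
      unfolding k_def using multiplicity_decompose'[of n p] less.prems p(1) by (auto simp: prime_nat_iff)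
    have "k > 0" using m p(2) by (cases k) auto
    have "m > 0" using m less.prems by (cases m) auto
    moreover have "p ^ k > 1" using p(1) \<open>k > 0\<close> by (intro one_less_power prime_gt_1_nat)
    ultimately have "m < n" using m(1) by simp
    then have "Q m" using less.IH \<open>m > 0\<close> by blast
    with p(1) \<open>k > 0\<close> \<open>m > 0\<close> m(2) show ?thesis unfolding m(1) by (rule step)
  qed
qed

text \<open>These are the real Dirichlet characters modulo \<open>P\<close>, the principal one
  included.\<close>

locale real_character =
  fixes \<chi> :: "nat \<Rightarrow> int" and P :: nat
  assumes modulus_pos: "P > 0"
    and mult: "\<chi> (a * b) = \<chi> a * \<chi> b"
    and periodic: "\<chi> (a + P) = \<chi> a"
    and range: "\<chi> a \<in> {-1, 0, 1}"
    and nonzero_iff: "\<chi> a \<noteq> 0 \<longleftrightarrow> coprime a P"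
begin

lemma chi_one: "\<chi> 1 = 1"
proof -
  have "\<chi> 1 * \<chi> 1 = \<chi> 1" using mult[of 1 1] by simp
  moreover have "\<chi> 1 \<noteq> 0" by (subst nonzero_iff) simp
  ultimately show ?thesis by simp
qed

lemma chi_power: "\<chi> (a ^ k) = \<chi> a ^ k"
  using chi_one by (induction k) (auto simp: mult)

lemma chi_cong: "[a = b] (mod P) \<Longrightarrow> \<chi> a = \<chi> b"
proof -
  have "\<chi> (x + k * P) = \<chi> x" for x k
    by (induction k) (auto simp: periodic add.assoc[symmetric] add.commute[of P])
  from this[of "x mod P" "x div P" for x] have "\<chi> x = \<chi> (x mod P)" for x
    by simp
  then show "[a = b] (mod P) \<Longrightarrow> \<chi> a = \<chi> b" by (metis cong_def)
qed

definition divisor_sum :: "nat \<Rightarrow> int" where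
  "divisor_sum n = (\<Sum>d | d dvd n. \<chi> d)"

lemma divisor_sum_coprime_mult:
  assumes "coprime a b" "a > 0" "b > 0"
  shows "divisor_sum (a * b) = divisor_sum a * divisor_sum b"
proof -
  have "divisor_sum a * divisor_sum b = (\<Sum>(d, e)\<in>{d. d dvd a} \<times> {e. e dvd b}. \<chi> (d * e))"
    by (simp add: divisor_sum_def sum_product sum.cartesian_product mult)
  also have "\<dots> = (\<Sum>d | d dvd a * b. \<chi> d)"
  proof -
    have "inj_on (\<lambda>(d, e). d * e) ({d. d dvd a} \<times> {e. e dvd b})"
    proof (rule inj_onI, clarsimp)
      fix d e d' e' :: nat
      assume dvd: "d dvd a" "e dvd b" "d' dvd a" "e' dvd b" and eq: "d * e = d' * e'"
      have cop: "coprime x y" if "x dvd a" "y dvd b" for x y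
        using coprime_divisors[OF that assms(1)] .
      have "d dvd d' * e'" "d' dvd d * e" using eq by (metis dvd_triv_left)+
      then have "d dvd d'" "d' dvd d"
        using dvd cop by (simp_all add: coprime_dvd_mult_left_iff)
      then have "d = d'" by (rule dvd_antisym)
      moreover have "d > 0" using dvd(1) assms(2) by (rule dvd_pos_nat[rotated])
      ultimately show "d = d' \<and> e = e'" using eq by simp
    qed
    moreover have "(\<lambda>(d, e). d * e) ` ({d. d dvd a} \<times> {e. e dvd b}) = {d. d dvd a * b}"
    proof (intro equalityI subsetI)
      fix n assume "n \<in> {d. d dvd a * b}"
      then obtain d e where "n = d * e" "d dvd a" "e dvd b"
        using division_decomp[of n a b] by auto
      then show "n \<in> (\<lambda>(d, e). d * e) ` ({d. d dvd a} \<times> {e. e dvd b})" by auto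
    qed (auto intro: mult_dvd_mono)
    ultimately have "bij_betw (\<lambda>(d, e). d * e) ({d. d dvd a} \<times> {e. e dvd b}) {d. d dvd a * b}"
      by (simp add: bij_betw_def)
    from sum.reindex_bij_betw[OF this, of \<chi>] show ?thesis by (simp add: case_prod_beta)
  qed
  finally show ?thesis by (simp add: divisor_sum_def)
qed

lemma divisor_sum_prime_power:
  assumes "prime p"
  shows "divisor_sum (p ^ k) = (\<Sum>i\<le>k. \<chi> p ^ i)"
proof -
  have "{d. d dvd p ^ k} = (\<lambda>i. p ^ i) ` {..k}"
    using divides_primepow_nat[OF assms] by auto
  moreover have "inj_on (\<lambda>i. p ^ i) {..k}"
    using assms by (auto simp: inj_on_def dest: prime_power_inj)
  ultimately show ?thesis
    by (simp add: divisor_sum_def sum.reindex chi_power)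
qed

lemma sum_powers_minus_one: "(\<Sum>i\<le>k. (- 1 :: int) ^ i) = (if even k then 1 else 0)"
  by (induction k) auto

text \<open>The geometric sum is k + 1, is 1, or alternates between 1 and 0, according as
  \<open>\<chi> p\<close> is 1, 0 or -1.\<close>

lemma divisor_sum_prime_power_cases:
  assumes "prime p"
  shows "divisor_sum (p ^ k) \<ge> 0"
    and "even k \<Longrightarrow> divisor_sum (p ^ k) \<ge> 1"
    and "odd k \<Longrightarrow> \<chi> p = -1 \<Longrightarrow> divisor_sum (p ^ k) = 0"
  using range[of p] by (auto simp: divisor_sum_prime_power[OF assms] sum_powers_minus_one power_0_left sum.delta)

lemma divisor_sum_nonneg: "n > 0 \<Longrightarrow> divisor_sum n \<ge> 0"
proof (induction n rule: prime_power_induct)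
  case one
  then show ?case using chi_one by (simp add: divisor_sum_def)
next
  case (prime_power p k m)
  then have "coprime (p ^ k) m" by (simp add: prime_imp_coprime)
  then show ?case
    using prime_power divisor_sum_prime_power_cases(1)[of p k]
    by (simp add: divisor_sum_coprime_mult prime_gt_0_nat)
qed

lemma divisor_sum_square: "n > 0 \<Longrightarrow> divisor_sum (n\<^sup>2) \<ge> 1"
proof (induction n rule: prime_power_induct)
  case one
  then show ?case using chi_one by (simp add: divisor_sum_def)
next
  case (prime_power p k m)
  then have "coprime (p ^ (2 * k)) (m\<^sup>2)" by (simp add: prime_imp_coprime)
  then have "divisor_sum (p ^ (2 * k) * m\<^sup>2) = divisor_sum (p ^ (2 * k)) * divisor_sum (m\<^sup>2)"
    using prime_power by (simp add: divisor_sum_coprime_mult prime_gt_0_nat)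
  moreover have "1 * 1 \<le> divisor_sum (p ^ (2 * k)) * divisor_sum (m\<^sup>2)"
    using prime_power divisor_sum_prime_power_cases(2)[of p "2 * k"] by (intro mult_mono) auto
  ultimately show ?case by (simp add: power_mult_distrib power_mult[symmetric] mult.commute)
qed

text \<open>By multiplicativity the local factor at \<open>p\<close> divides the divisor sum, and an
  odd exponent would make that factor vanish.\<close>

lemma even_multiplicity_if_divisor_sum_nonzero:
  assumes "divisor_sum n \<noteq> 0" "n > 0" "prime p" "\<chi> p = -1"
  shows "even (multiplicity p n)"
proof (rule ccontr)
  assume odd: "odd (multiplicity p n)"
  obtain m where m: "n = p ^ multiplicity p n * m" "\<not> p dvd m"
    using multiplicity_decompose'[of n p] assms(2,3) by (auto simp: prime_nat_iff)
  have "m > 0" using m assms(2) by (cases m) auto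
  have "coprime (p ^ multiplicity p n) m" using m(2) assms(3) by (simp add: prime_imp_coprime)
  then have "divisor_sum n = divisor_sum (p ^ multiplicity p n) * divisor_sum m"
    using divisor_sum_coprime_mult[of "p ^ multiplicity p n" m] \<open>m > 0\<close> prime_gt_0_nat[OF assms(3)]
    by (simp flip: m(1))
  then show False
    using divisor_sum_prime_power_cases(3)[OF assms(3) odd assms(4)] assms(1) by simp
qed

lemma sum_residue_solutions:
  assumes "coprime d P"
  shows "(\<Sum>e<P. of_bool [d * e = c] (mod P)) = (1::real)"
proof -
  obtain x where x: "[d * x = c] (mod P)"
    using cong_solve_dvd_nat[of d P c] assms by auto
  have "{e \<in> {..<P}. [d * e = c] (mod P)} = {x mod P}"
  proof (intro equalityI subsetI)
    fix e assume "e \<in> {e \<in> {..<P}. [d * e = c] (mod P)}"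
    then have "[d * e = d * x] (mod P)" "e < P" using x by (auto dest: cong_sym cong_trans)
    then have "[e = x] (mod P)" using assms by (simp add: cong_mult_lcancel_nat)
    then show "e \<in> {x mod P}" using \<open>e < P\<close> by (simp add: cong_def)
  next
    fix e assume "e \<in> {x mod P}"
    then show "e \<in> {e \<in> {..<P}. [d * e = c] (mod P)}"
      using x modulus_pos by (auto simp: cong_def mod_simps)
  qed
  then show ?thesis
    by (simp add: sum.If_cases of_bool_def Int_def conj_commute)
qed

text \<open>The pair kernel counting divisors of numbers \<open>\<equiv> c\<close> minus those of numbers \<open>\<equiv> 1\<close>
  has mean zero in each variable because \<open>\<chi> c = \<chi> 1\<close>; hence the weighted divisor sums over both
  residue classes differ by a bounded amount.\<close>

lemma exists_residue_divisor_sum_nonzero: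
  assumes "\<chi> c = 1"
  shows "\<exists>n>0. [n = c] (mod P) \<and> divisor_sum n \<noteq> 0"
proof (rule ccontr)
  assume "\<not> (\<exists>n>0. [n = c] (mod P) \<and> divisor_sum n \<noteq> 0)"
  then have vanish: "divisor_sum n = 0" if "n > 0" "[n = c] (mod P)" for n using that by blast
  have cop_c: "coprime c P" using assms nonzero_iff[of c] by simp
  define h :: "nat \<Rightarrow> real" where "h n = of_bool [n = c] (mod P) - of_bool [n = 1] (mod P)" for n
  define f where "f d e = of_int (\<chi> d) * h (d * e)" for d e
  have h_cong: "h a = h b" if "[a = b] (mod P)" for a b
    using that by (auto simp: h_def of_bool_def dest: cong_trans cong_sym)
  have per1: "f (d + P) e = f d e" for d e
    unfolding f_def periodic by (subst h_cong[of "(d + P) * e" "d * e"])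
      (auto simp: cong_def add_mult_distrib)
  have per2: "f d (e + P) = f d e" for d e
    unfolding f_def by (subst h_cong[of "d * (e + P)" "d * e"]) (auto simp: cong_def add_mult_distrib2)
  have bound: "\<bar>f d e\<bar> \<le> 1" for d e
    using range[of d] by (auto simp: f_def h_def)
  have mean2: "(\<Sum>e<P. f d e) = 0" for d
  proof (cases "coprime d P")
    case True
    then show ?thesis
      unfolding f_def h_def sum_distrib_left[symmetric] sum_subtractf
      by (simp only: sum_residue_solutions) simp
  next
    case False
    then show ?thesis using nonzero_iff[of d] by (simp add: f_def)
  qed
  have mean1: "(\<Sum>d<P. f d e) = 0" for e
  proof -
    \<comment> \<open>Where \<open>h (d * e)\<close> is nonzero,
      \<open>\<chi> d * \<chi> e = 1\<close> and so \<open>\<chi> d = \<chi> e\<close>. Hence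
      \<open>f\<close> is symmetric and its mean in \<open>d\<close> reduces to that in
      \<open>e\<close>.\<close>
    have "f d e = of_int (\<chi> e) * h (d * e)" for d
    proof (cases "[d * e = c] (mod P) \<or> [d * e = 1] (mod P)")
      case True
      then have "\<chi> (d * e) = 1" using chi_cong assms chi_one by metis
      then have "\<chi> d = \<chi> e" using range[of d] range[of e] by (auto simp: mult)
      then show ?thesis by (simp add: f_def)
    next
      case False
      then show ?thesis by (simp add: f_def h_def del: One_nat_def)
    qed
    then have "f d e = f e d" for d by (simp add: f_def mult.commute)
    then have "(\<Sum>d<P. f d e) = (\<Sum>d<P. f e d)" by (rule sum.cong[OF refl])
    then show ?thesis by (simp add: mean2)
  qed
  \<comment> \<open>\<open>K\<close> is the hyperbola bound, \<open>J\<close> is chosen so that ln J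
    > P K, and \<open>s\<close> is such that all squares (1 + j P)^2 with j < J lie below
    s^2.\<close>
  define K where "K = 4 * real P ^ 2 + 8 * real P"
  define J where "J = nat \<lceil>exp (P * K)\<rceil> + 1"
  define s where "s = 1 + J * P"
  let ?T = "\<lambda>n. h n * of_int (divisor_sum n) / sqrt n"
  have "(\<Sum>n\<in>{1..s\<^sup>2}. ?T n) = (\<Sum>n\<in>{1..s\<^sup>2}. \<Sum>d | d dvd n. f d (n div d) / (sqrt d * sqrt (n div d)))"
  proof (intro sum.cong refl)
    fix n assume n: "n \<in> {1..s\<^sup>2}"
    have "f d (n div d) / (sqrt d * sqrt (n div d)) = h n / sqrt n * of_int (\<chi> d)" if "d dvd n" for d
    proof -
      have "d * (n div d) = n" using that by simp
      moreover have "sqrt d * sqrt (n div d) = sqrt n"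
        by (simp add: calculation flip: real_sqrt_mult of_nat_mult)
      ultimately show ?thesis by (simp add: f_def)
    qed
    then have "(\<Sum>d | d dvd n. f d (n div d) / (sqrt d * sqrt (n div d)))
        = (\<Sum>d | d dvd n. h n / sqrt n * of_int (\<chi> d))"
      by (intro sum.cong) auto
    then show "?T n = (\<Sum>d | d dvd n. f d (n div d) / (sqrt d * sqrt (n div d)))"
      by (simp add: divisor_sum_def sum_distrib_left sum_divide_distrib)
  qed
  also have "\<dots> = (\<Sum>(d, e)\<in>hyperbola_region (s\<^sup>2). f d e / (sqrt d * sqrt e))"
    by (rule sum_divisors_hyperbola[of "\<lambda>d e. f d e / (sqrt d * sqrt e)" "s\<^sup>2"])
  finally have "\<bar>\<Sum>n\<in>{1..s\<^sup>2}. ?T n\<bar> \<le> K"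
    using hyperbola_sum_bound[of P f s] modulus_pos per1 per2 mean1 mean2 bound
    unfolding K_def by simp
  then have upper: "(\<Sum>n\<in>{1..s\<^sup>2}. - ?T n) \<le> K" by (simp add: sum_negf)
  define g where "g j = (1 + j * P)\<^sup>2" for j
  \<comment> \<open>The class of \<open>c\<close> contributes nothing by assumption, so only the
    class of 1 remains, and \<open>h\<close> is -1 on it.\<close>
  have T_nonneg: "- ?T n \<ge> 0" if "n > 0" for n
    using vanish[OF that] divisor_sum_nonneg[OF that]
    by (cases "[n = c] (mod P)") (auto simp: h_def)
  \<comment> \<open>The square of 1 + j P lies in the class of 1 and has positive divisor sum, which
    also keeps it out of the class of \<open>c\<close>. These terms alone dominate a divergent
    series.\<close>
  have T_square: "- ?T (g j) \<ge> 1 / real (1 + j * P)" for j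
  proof -
    have "[1 + j * P = 1] (mod P)" unfolding cong_def by (rule mod_mult_self1)
    then have one: "[g j = 1] (mod P)" unfolding g_def using cong_pow by fastforce
    have ge1: "divisor_sum (g j) \<ge> 1" unfolding g_def by (rule divisor_sum_square) simp
    have "\<not> [g j = c] (mod P)" using vanish[of "g j"] ge1 by (auto simp: g_def)
    then have "- ?T (g j) = of_int (divisor_sum (g j)) / sqrt (g j)" using one by (simp add: h_def)
    moreover have "sqrt (g j) = real (1 + j * P)"
      unfolding g_def of_nat_power by (rule real_sqrt_unique) auto
    ultimately show ?thesis using ge1 by (simp add: divide_right_mono)
  qed
  have inj: "inj_on g {..<J}"
    using modulus_pos by (auto simp: inj_on_def g_def power2_eq_iff_nonneg)
  have sub: "g ` {..<J} \<subseteq> {1..s\<^sup>2}"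
    by (auto simp: g_def s_def intro!: power_mono)
  have "ln (real s) / P \<le> (\<Sum>j<J. 1 / real (1 + j * P))"
    unfolding s_def by (rule sum_inverse_arith_progression_ge[OF modulus_pos])
  also have "\<dots> \<le> (\<Sum>j<J. - ?T (g j))" by (intro sum_mono T_square)
  also have "\<dots> = (\<Sum>n\<in>g ` {..<J}. - ?T n)" by (simp add: sum.reindex[OF inj])
  also have "\<dots> \<le> (\<Sum>n\<in>{1..s\<^sup>2}. - ?T n)"
    using sub T_nonneg by (intro sum_mono2) auto
  finally have "ln (real s) / P \<le> K" using upper by simp
  then have "ln (real s) \<le> P * K" using modulus_pos by (simp add: field_simps)
  then have "real s \<le> exp (P * K)"
    using exp_le_cancel_iff[of "ln (real s)" "P * K"] by (simp add: s_def add_pos_nonneg)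
  moreover have "exp (P * K) < real J" unfolding J_def by linarith
  moreover have "J \<le> J * P" using modulus_pos by simp
  then have "real J \<le> real s" unfolding s_def by (intro of_nat_mono trans_le_add2)
  ultimately show False by linarith
qed

end

section \<open>Sums of three squares\<close>

lemma Legendre_values: "Legendre a p \<in> {-1, 0, 1}"
  by (simp add: Legendre_def)

lemma Legendre_cong: "[a = b] (mod p) \<Longrightarrow> Legendre a p = Legendre b p"
  unfolding Legendre_def QuadRes_def cong_def by simp

text \<open>Euler's criterion gives a congruence modulo \<open>p\<close>; values in {-1, 0, 1}
  differ by at most 2 < p, so it is an equality.\<close>

lemma Legendre_eqI:
  assumes "prime p" "2 < p" "[a ^ ((p - 1) div 2) = c] (mod int p)" "c \<in> {-1, 0, 1}"
  shows "Legendre a (int p) = c"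
proof -
  have "[Legendre a p = c] (mod int p)"
    using euler_criterion[OF assms(1,2)] assms(3) by (rule cong_trans)
  then have "int p dvd Legendre a p - c" by (simp add: cong_iff_dvd_diff)
  moreover have "\<bar>Legendre a p - c\<bar> < int p"
    using Legendre_values[of a p] assms(2,4) by auto
  ultimately show ?thesis using dvd_imp_le_int[of "Legendre a p - c" "int p"] by force
qed

lemma Legendre_mult:
  assumes "prime p" "2 < p"
  shows "Legendre (a * b) (int p) = Legendre a p * Legendre b p"
proof (rule Legendre_eqI[OF assms])
  show "[(a * b) ^ ((p - 1) div 2) = Legendre a p * Legendre b p] (mod int p)"
    unfolding power_mult_distrib by (intro cong_mult cong_sym[OF euler_criterion[OF assms]])
  show "Legendre a p * Legendre b p \<in> {-1, 0, 1}"
    using Legendre_values[of a p] Legendre_values[of b p] by auto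
qed

lemma Legendre_minus_one:
  assumes "prime p" "2 < p"
  shows "Legendre (-1) (int p) = (if p mod 4 = 1 then 1 else -1)"
proof (rule Legendre_eqI[OF assms])
  have "odd p" using assms prime_odd_nat by blast
  have "even ((p - 1) div 2) \<longleftrightarrow> p mod 4 = 1"
    using \<open>odd p\<close> by presburger
  then show "[(- 1) ^ ((p - 1) div 2) = (if p mod 4 = 1 then 1 else -1)] (mod int p)" by simp
qed simp

text \<open>Gauss's lemma with multiplier 2: the sign is the parity of the number of doubles 2 x, 1
  <= x <= h = (p - 1) / 2, that exceed h.\<close>

lemma Legendre_two:
  assumes "prime p" "2 < p"
  shows "Legendre 2 (int p) = (if p mod 8 \<in> {1, 7} then 1 else -1)"
proof -
  have "odd p" using assms prime_odd_nat by blast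
  interpret GAUSS p 2
    using assms by unfold_locales (auto simp: cong_def)
  define h where "h = (int p - 1) div 2"
  have h: "int p = 2 * h + 1" using \<open>odd p\<close> unfolding h_def by presburger
  \<comment> \<open>Doubles of numbers up to \<open>h\<close> stay below \<open>p\<close>, so
    reducing them modulo \<open>p\<close> changes nothing.\<close>
  have "C = B"
  proof -
    have "x mod int p = x" if "x \<in> B" for x
      using that h unfolding B_def A_def h_def[symmetric] by auto
    then show ?thesis unfolding C_def by force
  qed
  then have "E = (\<lambda>x. x * 2) ` {h div 2 <.. h}"
    unfolding E_def B_def A_def h_def[symmetric] using h assms(2) by (auto simp: image_iff)
  then have "card E = nat (h - h div 2)"
    by (simp add: card_image inj_on_def)
  moreover have "even (nat (h - h div 2)) \<longleftrightarrow> p mod 8 \<in> {1, 7}"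
  proof -
    have "h - h div 2 \<ge> 0" using h assms(2) by linarith
    then have "even (nat (h - h div 2)) \<longleftrightarrow> even (h - h div 2)" by (simp add: even_nat_iff)
    also have "\<dots> \<longleftrightarrow> int p mod 8 = 1 \<or> int p mod 8 = 7" unfolding h by presburger
    also have "\<dots> \<longleftrightarrow> p mod 8 \<in> {1, 7}"
      using zmod_int[of p 8] by auto
    finally show ?thesis .
  qed
  ultimately show ?thesis using gauss_lemma by simp
qed

lemma Legendre_minus_two:
  assumes "prime p" "2 < p"
  shows "Legendre (-2) (int p) = (if p mod 8 \<in> {1, 3} then 1 else -1)"
proof -
  have "odd p" using assms prime_odd_nat by blast
  then have "p mod 8 \<in> {1, 3, 5, 7}" by (simp, presburger)
  moreover have "p mod 4 = p mod 8 mod 4" by (simp add: mod_mod_cancel)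
  moreover have "Legendre (-2) (int p) = Legendre (-1) p * Legendre 2 p"
    using Legendre_mult[OF assms, of "-1" 2] by simp
  ultimately show ?thesis
    using Legendre_minus_one[OF assms] Legendre_two[OF assms] by auto
qed

section \<open>Jacobi symbols, reciprocity and the character of discriminant -8n\<close>

definition Jacobi :: "nat \<Rightarrow> nat \<Rightarrow> int" where
  "Jacobi b n = (\<Prod>p\<in>#prime_factorization n. Legendre (int b) (int p))"

lemma odd_prime_factor_gt_2:
  assumes "odd n" "p \<in># prime_factorization (n::nat)"
  shows "prime p" "2 < p" "p dvd n"
proof -
  show p: "prime p" "p dvd n" using assms(2) by auto
  then have "p \<noteq> 2" using assms(1) by auto
  then show "2 < p" using prime_ge_2_nat[OF p(1)] by simp
qed

lemma prod_mset_units: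
  fixes f :: "'a \<Rightarrow> int"
  assumes "\<And>x. x \<in># A \<Longrightarrow> f x \<in> {-1, 0, 1}"
  shows "(\<Prod>x\<in>#A. f x) \<in> {-1, 0, 1}"
  using assms
proof (induction A)
  case (add x A)
  then have "f x \<in> {-1, 0, 1}" "(\<Prod>x\<in>#A. f x) \<in> {-1, 0, 1}" by simp_all
  then show ?case by auto
qed simp

lemma Jacobi_values: "Jacobi b n \<in> {-1, 0, 1}"
  unfolding Jacobi_def by (intro prod_mset_units Legendre_values)

lemma Jacobi_mult:
  assumes "odd n"
  shows "Jacobi (a * b) n = Jacobi a n * Jacobi b n"
proof -
  have "Jacobi (a * b) n = (\<Prod>p\<in>#prime_factorization n. Legendre (int a) p * Legendre (int b) p)"
    unfolding Jacobi_def using odd_prime_factor_gt_2[OF assms]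
    by (intro arg_cong[of _ _ prod_mset] image_mset_cong) (auto simp: Legendre_mult)
  then show ?thesis by (simp add: Jacobi_def prod_mset.distrib)
qed

lemma Jacobi_cong:
  assumes "[a = b] (mod n)"
  shows "Jacobi a n = Jacobi b n"
  unfolding Jacobi_def
proof (intro arg_cong[of _ _ prod_mset] image_mset_cong Legendre_cong)
  fix p assume "p \<in># prime_factorization n"
  then have "[a = b] (mod p)" using assms by (auto intro: cong_dvd_modulus_nat)
  then show "[int a = int b] (mod int p)" by (simp add: cong_int_iff)
qed

lemma Jacobi_eq_0_iff:
  assumes "n > 0"
  shows "Jacobi b n = 0 \<longleftrightarrow> \<not> coprime b n"
proof -
  have "Jacobi b n = 0 \<longleftrightarrow> (\<exists>p. prime p \<and> p dvd n \<and> Legendre (int b) (int p) = 0)"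
    using assms by (auto simp: Jacobi_def prime_factors_dvd)
  also have "\<dots> \<longleftrightarrow> (\<exists>p. prime p \<and> p dvd n \<and> p dvd b)"
    by (auto simp: Legendre_def cong_0_iff)
  also have "\<dots> \<longleftrightarrow> \<not> coprime b n"
    by (metis coprime_iff_gcd_eq_1 gcd_nat.bounded_iff not_prime_unit prime_factor_nat is_unit_gcd_iff)
  finally show ?thesis .
qed

text \<open>For odd \<open>n\<close> this is (-1)^((n - 1) / 2), the Jacobi symbol of -1 over
  \<open>n\<close>.\<close>

definition sign4 :: "nat \<Rightarrow> int" where
  "sign4 n = (if n mod 4 = 1 then 1 else -1)"

lemma sign4_mult: "odd a \<Longrightarrow> odd b \<Longrightarrow> sign4 (a * b) = sign4 a * sign4 b"
proof -
  assume "odd a" "odd b"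
  then have "a mod 4 = 1 \<or> a mod 4 = 3" "b mod 4 = 1 \<or> b mod 4 = 3" by presburger+
  moreover have "a * b mod 4 = (a mod 4) * (b mod 4) mod 4" by (simp add: mod_mult_eq)
  ultimately show ?thesis by (auto simp: sign4_def)
qed

lemma sign4_prime_factors:
  assumes "n > 0" "odd n"
  shows "(\<Prod>p\<in>#prime_factorization n. sign4 p) = sign4 n"
proof -
  have "(\<forall>p\<in>#A. odd p) \<Longrightarrow> odd (prod_mset A) \<and> (\<Prod>p\<in>#A. sign4 p) = sign4 (prod_mset A)" for A
    by (induction A) (auto simp: sign4_mult, simp add: sign4_def)
  then have "(\<Prod>p\<in>#prime_factorization n. sign4 p) = sign4 (prod_mset (prime_factorization n))"
    using odd_prime_factor_gt_2[OF assms(2)] prime_odd_nat by blast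
  then show ?thesis using assms(1) by (simp add: prod_mset_prime_factorization_nat)
qed

text \<open>The upper entry of \<open>Jacobi\<close> is a natural number, so -1 enters through a
  representative \<open>b\<close>; each prime factor \<open>p\<close> contributes
  \<open>sign4 p\<close>.\<close>

lemma Jacobi_minus_one:
  assumes "odd n" "n > 0" "[b + 1 = 0] (mod n)"
  shows "Jacobi b n = sign4 n"
proof -
  have "Legendre (int b) (int p) = sign4 p" if p: "p \<in># prime_factorization n" for p
  proof -
    have "p dvd b + 1"
      using odd_prime_factor_gt_2(3)[OF assms(1) p] assms(3) dvd_trans unfolding cong_0_iff by blast
    then have "int p dvd int (b + 1)" by (simp only: int_dvd_int_iff)
    then have "int p dvd int b - (-1)" by (simp add: add.commute)
    then have "Legendre (int b) p = Legendre (-1) p"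
      by (intro Legendre_cong) (simp add: cong_iff_dvd_diff)
    then show ?thesis
      using odd_prime_factor_gt_2[OF assms(1) p] by (simp add: Legendre_minus_one sign4_def)
  qed
  then have "Jacobi b n = (\<Prod>p\<in>#prime_factorization n. sign4 p)"
    unfolding Jacobi_def by (intro arg_cong[of _ _ prod_mset] image_mset_cong) auto
  then show ?thesis using assms by (simp add: sign4_prime_factors)
qed

lemma Legendre_prod_mset:
  assumes "prime q" "2 < q"
  shows "Legendre (int (prod_mset A)) (int q) = (\<Prod>p\<in>#A. Legendre (int p) (int q))"
proof (induction A)
  case empty
  have "[1 \<noteq> 0] (mod int q)" using assms(2) by (simp add: cong_def)
  moreover have "QuadRes (int q) 1" unfolding QuadRes_def by (rule exI[of _ 1]) simp
  ultimately show ?case by (simp add: Legendre_def)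
qed (simp add: Legendre_mult[OF assms])

text \<open>Quadratic reciprocity at each prime factor \<open>p\<close> of \<open>n\<close> costs
  the sign 1 if q = 1 mod 4 and \<open>sign4 p\<close> otherwise; multiplicativity of
  \<open>sign4\<close> collects these signs.\<close>

lemma Jacobi_reciprocity:
  assumes "odd n" "n > 0" "prime q" "2 < q" "\<not> q dvd n"
  shows "Legendre (int n) (int q) = (if q mod 4 = 1 then 1 else sign4 n) * Jacobi q n"
proof -
  define \<epsilon> where "\<epsilon> p = (if q mod 4 = 1 then 1 else sign4 p)" for p
  have "odd q" using assms prime_odd_nat by blast
  have "Legendre (int p) (int q) = \<epsilon> p * Legendre (int q) (int p)"
    if p: "p \<in># prime_factorization n" for p
  proof -
    note pp = odd_prime_factor_gt_2[OF assms(1) p]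
    have "odd p" using pp prime_odd_nat by blast
    have "p \<noteq> q" using pp(3) assms(5) by auto
    then have qr: "Legendre p q * Legendre q p = (-1) ^ ((p - 1) div 2 * ((q - 1) div 2))"
      using Quadratic_Reciprocity pp assms by blast
    have "even ((q - 1) div 2) \<longleftrightarrow> q mod 4 = 1" "even ((p - 1) div 2) \<longleftrightarrow> p mod 4 = 1"
      using \<open>odd q\<close> \<open>odd p\<close> by presburger+
    then have "Legendre p q * Legendre q p = \<epsilon> p"
      unfolding qr by (auto simp: \<epsilon>_def sign4_def minus_one_power_iff)
    moreover have "\<epsilon> p \<in> {-1, 1}" by (simp add: \<epsilon>_def sign4_def)
    ultimately show ?thesis
      using Legendre_values[of p q] Legendre_values[of q p] by auto
  qed
  then have "(\<Prod>p\<in>#prime_factorization n. Legendre p q) = (\<Prod>p\<in>#prime_factorization n. \<epsilon> p * Legendre (int q) p)"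
    by (intro arg_cong[of _ _ prod_mset] image_mset_cong)
  also have "\<dots> = (\<Prod>p\<in>#prime_factorization n. \<epsilon> p) * Jacobi q n"
    by (simp add: Jacobi_def prod_mset.distrib)
  also have "(\<Prod>p\<in>#prime_factorization n. \<epsilon> p) = (if q mod 4 = 1 then 1 else sign4 n)"
    using sign4_prime_factors assms(1,2) by (simp add: \<epsilon>_def)
  finally show ?thesis
    using Legendre_prod_mset[OF assms(3,4), of "prime_factorization n"] assms(2)
    by (simp add: prod_mset_prime_factorization_nat)
qed

text \<open>For odd \<open>b\<close> coprime to \<open>n\<close>, \<open>twist8 n b * Jacobi b n\<close> is the Jacobi symbol of
  \<open>-2n\<close> modulo \<open>b\<close>, written so that periodicity in \<open>b\<close> is evident.\<close>

definition twist8 :: "nat \<Rightarrow> nat \<Rightarrow> int" where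
  "twist8 n b = (if even b then 0
     else if b mod 8 = 1 \<or> b mod 8 = (if n mod 4 = 1 then 3 else 7) then 1 else -1)"

lemma odd_mod_8: "odd (b::nat) \<Longrightarrow> b mod 8 = 1 \<or> b mod 8 = 3 \<or> b mod 8 = 5 \<or> b mod 8 = 7"
  by presburger

lemma twist8_mult: "twist8 n (a * b) = twist8 n a * twist8 n b"
proof (cases "odd a \<and> odd b")
  case True
  define x y where "x = a mod 8" and "y = b mod 8"
  have "a * b mod 8 = x * y mod 8" by (simp add: x_def y_def mod_mult_eq)
  moreover have "x = 1 \<or> x = 3 \<or> x = 5 \<or> x = 7" "y = 1 \<or> y = 3 \<or> y = 5 \<or> y = 7"
    using True odd_mod_8 by (simp_all add: x_def y_def)
  ultimately show ?thesis
    using True unfolding twist8_def x_def[symmetric] y_def[symmetric] by (elim disjE; simp)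
qed (auto simp: twist8_def)

text \<open>For odd \<open>n\<close>, the Kronecker symbol of -8n.\<close>

definition discriminant_char :: "nat \<Rightarrow> nat \<Rightarrow> int" where
  "discriminant_char n b = twist8 n b * Jacobi b n"

lemma real_character_discriminant_char:
  assumes "odd n"
  shows "real_character (discriminant_char n) (8 * n)"
proof
  have "n > 0" using assms by (cases n) auto
  then show "8 * n > 0" by simp
  fix a b
  show "discriminant_char n (a * b) = discriminant_char n a * discriminant_char n b"
    by (simp add: discriminant_char_def twist8_mult Jacobi_mult[OF assms])
  have "Jacobi (a + 8 * n) n = Jacobi a n"
    by (rule Jacobi_cong) (simp add: cong_def)
  then show "discriminant_char n (a + 8 * n) = discriminant_char n a"
    by (simp add: discriminant_char_def twist8_def)
  show "discriminant_char n a \<in> {-1, 0, 1}"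
    using Jacobi_values[of a n] by (auto simp: discriminant_char_def twist8_def)
  have "coprime a 8 \<longleftrightarrow> odd a"
    using coprime_power_right_iff[of a 2 3] by simp
  then show "discriminant_char n a \<noteq> 0 \<longleftrightarrow> coprime a (8 * n)"
    using Jacobi_eq_0_iff[OF \<open>n > 0\<close>, of a]
    by (auto simp: discriminant_char_def twist8_def)
qed

lemma discriminant_char_prime:
  assumes "odd n" "prime q" "discriminant_char n q = 1"
  shows "QuadRes (int q) (- 2 * int n)"
proof -
  have "n > 0" using assms(1) by (cases n) auto
  have "odd q" using assms(3) by (auto simp: discriminant_char_def twist8_def split: if_splits)
  then have "2 < q" using prime_ge_2_nat[OF assms(2)] by (cases "q = 2") auto
  have "coprime q n"
    using assms(3) Jacobi_eq_0_iff[OF \<open>n > 0\<close>, of q] by (auto simp: discriminant_char_def)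
  then have "\<not> q dvd n" using assms(2) by (metis coprime_absorb_left not_prime_unit)
  have "n mod 4 = 1 \<or> n mod 4 = 3" using assms(1) by presburger
  moreover have "q mod 4 = q mod 8 mod 4" by (simp add: mod_mod_cancel)
  \<comment> \<open>The symbol of -2 times the reciprocity sign is the symbol of -2 if n = 1 mod 4
    and that of 2 if n = 3 mod 4: the two cases of \<open>twist8\<close>.\<close>
  ultimately have "Legendre (-2) q * (if q mod 4 = 1 then 1 else sign4 n) = twist8 n q"
    unfolding Legendre_minus_two[OF assms(2) \<open>2 < q\<close>] twist8_def sign4_def
    using odd_mod_8[OF \<open>odd q\<close>] \<open>odd q\<close> by auto
  then have "Legendre (-2 * int n) q = discriminant_char n q"
    unfolding Legendre_mult[OF assms(2) \<open>2 < q\<close>] discriminant_char_def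
      Jacobi_reciprocity[OF assms(1) \<open>n > 0\<close> assms(2) \<open>2 < q\<close> \<open>\<not> q dvd n\<close>]
    by (simp flip: mult.assoc)
  then show ?thesis using assms(3) by (simp add: Legendre_def split: if_splits)
qed

text \<open>\<open>2 * n - 1\<close> lifts the class of -1 modulo 2n to modulus 8n; both factors of
  the character equal \<open>sign4 n\<close> there.\<close>

lemma discriminant_char_residue:
  assumes "odd n"
  shows "discriminant_char n (2 * n - 1) = 1"
proof -
  have "n > 0" using assms by (cases n) auto
  then have "Jacobi (2 * n - 1) n = sign4 n"
    by (intro Jacobi_minus_one assms) (simp_all add: cong_def)
  moreover have "twist8 n (2 * n - 1) = sign4 n"
  proof -
    have "n mod 4 = 1 \<or> n mod 4 = 3" using assms by presburger
    then have "2 * n - 1 = 8 * (n div 4) + (if n mod 4 = 1 then 1 else 5)"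
      using div_mult_mod_eq[of n 4] by (elim disjE; simp)
    then have "(2 * n - 1) mod 8 = (if n mod 4 = 1 then 1 else 5)" by simp
    moreover have "odd (2 * n - 1)" using \<open>n > 0\<close> by simp
    ultimately show ?thesis by (auto simp: twist8_def sign4_def)
  qed
  ultimately show ?thesis by (simp add: discriminant_char_def sign4_def)
qed

section \<open>Twice an odd number as a sum of three squares\<close>

lemma QuadRes_squarefree:
  assumes "m > 0" "squarefree m" "\<And>q. prime q \<Longrightarrow> q dvd m \<Longrightarrow> QuadRes (int q) a"
  shows "QuadRes (int m) a"
  using assms
proof (induction m rule: prime_power_induct)
  case one
  then show ?case by (simp add: QuadRes_def)
next
  case (prime_power p k m)
  have "squarefree (p ^ k)" "squarefree m"
    using prime_power.prems(1) squarefree_multD by blast+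
  then have "k = 1" using prime_power.hyps(1,2) by (auto simp: squarefree_power_iff)
  have "QuadRes (int m) a"
    using prime_power.IH \<open>squarefree m\<close> prime_power.prems(2) dvd_mult by blast
  then obtain x where x: "[x\<^sup>2 = a] (mod int m)" unfolding QuadRes_def by blast
  have "p dvd p ^ k * m" using \<open>k = 1\<close> by simp
  then have "QuadRes (int p) a" using prime_power.prems(2) prime_power.hyps(1) by blast
  then obtain y where y: "[y\<^sup>2 = a] (mod int p)" unfolding QuadRes_def by blast
  have cop: "coprime (int p) (int m)"
    using prime_power.hyps by (simp add: prime_imp_coprime)
  then obtain z where z: "[z = y] (mod int p)" "[z = x] (mod int m)"
    using binary_chinese_remainder_int by blast
  have "[z\<^sup>2 = a] (mod int p)" "[z\<^sup>2 = a] (mod int m)"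
    using z x y by (blast intro: cong_pow cong_trans)+
  then have "[z\<^sup>2 = a] (mod int p * int m)" using cop by (rule coprime_cong_mult)
  then have "QuadRes (int p * int m) a" unfolding QuadRes_def by blast
  then show ?case using \<open>k = 1\<close> by simp
qed

text \<open>The form is \<open>((f(mx + by) + Nz)\<^sup>2 + mx\<^sup>2 + 2bxy + hy\<^sup>2) / N\<close>, where \<open>b\<^sup>2 + N = mh\<close>:
  it is integral of determinant 1 and takes the value \<open>N\<close> at \<open>(0, 0, 1)\<close>.\<close>

lemma sum_of_three_squares_criterion:
  fixes N m f b :: int
  assumes "m > 0" "N > 0" "[m * f\<^sup>2 = -1] (mod N)" "[b\<^sup>2 = - N] (mod m)"
  shows "\<exists>r s t. N = r\<^sup>2 + s\<^sup>2 + t\<^sup>2"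
proof -
  obtain g where g: "m * f\<^sup>2 + 1 = N * g" using assms(3) by (auto simp: cong_iff_dvd_diff)
  obtain h where h: "b\<^sup>2 + N = m * h" using assms(4) by (auto simp: cong_iff_dvd_diff)
  have "N * g > 0" unfolding g[symmetric] using assms(1) by (simp add: add_nonneg_pos)
  then have "g > 0" using assms(2) by (simp add: zero_less_mult_iff)
  have "coprime N m"
  proof (rule coprimeI)
    fix c assume "c dvd N" "c dvd m"
    then have "c dvd N * g - m * f\<^sup>2" by simp
    moreover have "N * g - m * f\<^sup>2 = 1" using g by simp
    ultimately show "is_unit c" by simp
  qed
  have "m * (f\<^sup>2 * b\<^sup>2 + h) = b\<^sup>2 * (m * f\<^sup>2 + 1) + N"
    using h by (simp add: algebra_simps)
  then have *: "m * (f\<^sup>2 * b\<^sup>2 + h) = N * (b\<^sup>2 * g + 1)"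
    unfolding g by (simp add: algebra_simps)
  \<comment> \<open>This divisibility makes the coefficient \<open>w\<close> of y^2
    integral.\<close>
  then have "N dvd f\<^sup>2 * b\<^sup>2 + h"
    using \<open>coprime N m\<close> by (metis coprime_dvd_mult_right_iff dvd_triv_left)
  then obtain w where w: "f\<^sup>2 * b\<^sup>2 + h = N * w" ..
  then have "N * (m * w) = N * (b\<^sup>2 * g + 1)"
    using * by (simp only: mult.left_commute)
  \<comment> \<open>This relation makes the leading minor equal to \<open>g\<close> and, with N g -
    m f^2 = 1, the determinant equal to 1.\<close>
  then have mw: "m * w - b\<^sup>2 * g = 1"
    using assms(2) by (simp only: mult_cancel_left) simp
  have "ternary_det (m * g) w N (b * g) (f * m) (f * b)
      = N * g * (m * w - b\<^sup>2 * g) - m * f\<^sup>2 * (m * w - b\<^sup>2 * g)"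
    by (simp add: ternary_det_def algebra_simps power2_eq_square)
  also have "\<dots> = 1" unfolding mw using g by linarith
  finally have det: "ternary_det (m * g) w N (b * g) (f * m) (f * b) = 1" .
  have "m * g * w - (b * g)\<^sup>2 = g * (m * w - b\<^sup>2 * g)"
    by (simp add: algebra_simps power2_eq_square)
  then have "m * g * w - (b * g)\<^sup>2 > 0" unfolding mw using \<open>g > 0\<close> by simp
  moreover have "m * g > 0" using assms(1) \<open>g > 0\<close> by simp
  ultimately have "\<exists>r s t. ternary_form (m * g) w N (b * g) (f * m) (f * b) 0 0 1 = r\<^sup>2 + s\<^sup>2 + t\<^sup>2"
    using det by (intro ternary_form_sum_of_three_squares)
  then show ?thesis by (simp add: ternary_form_def)
qed

lemma twice_odd_sum_of_three_squares:
  fixes n :: nat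
  assumes "odd n"
  shows "\<exists>r s t :: int. 2 * int n = r\<^sup>2 + s\<^sup>2 + t\<^sup>2"
proof -
  have "n > 0" using assms by (cases n) auto
  interpret real_character "discriminant_char n" "8 * n"
    by (rule real_character_discriminant_char[OF assms])
  obtain M where M: "M > 0" "[M = 2 * n - 1] (mod 8 * n)" "divisor_sum M \<noteq> 0"
    using exists_residue_divisor_sum_nonzero[OF discriminant_char_residue[OF assms]] by blast
  \<comment> \<open>Primes dividing the squarefree part have odd multiplicity in \<open>M\<close>,
    so the character is not -1 there; coprimality of \<open>M\<close> to 8n leaves only the value
    1.\<close>
  define m f where "m = squarefree_part M" and "f = square_part M"
  have decomp: "M = m * f\<^sup>2" unfolding m_def f_def by (rule squarefree_decompose)
  have "m > 0" using decomp M(1) by (cases m) auto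
  have "discriminant_char n M = 1"
    using chi_cong[OF M(2)] discriminant_char_residue[OF assms] by simp
  then have copM: "coprime M (8 * n)" using nonzero_iff[of M] by simp
  have "QuadRes (int m) (- 2 * int n)"
  proof (rule QuadRes_squarefree)
    show "squarefree m" by (simp add: m_def)
    fix q assume q: "prime q" "q dvd m"
    have "multiplicity q m = multiplicity q M mod 2"
      unfolding m_def using q(1) M(1) by (simp add: prime_multiplicity_squarefree_part)
    moreover have "multiplicity q m > 0"
      using q \<open>m > 0\<close> by (simp add: prime_multiplicity_gt_zero_iff)
    ultimately have "odd (multiplicity q M)" by presburger
    then have "discriminant_char n q \<noteq> -1"
      using even_multiplicity_if_divisor_sum_nonzero M q(1) by blast
    moreover have "coprime q (8 * n)"
      using copM q(2) decomp by (metis coprime_mult_left_iff dvdE)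
    then have "discriminant_char n q \<noteq> 0" using nonzero_iff by blast
    ultimately have "discriminant_char n q = 1" using range[of q] by auto
    then show "QuadRes (int q) (- 2 * int n)"
      by (rule discriminant_char_prime[OF assms q(1)])
  qed fact
  then obtain b where b: "[b\<^sup>2 = - (2 * int n)] (mod int m)" by (auto simp: QuadRes_def)
  have "[M = 2 * n - 1] (mod 2 * n)" using M(2) by (rule cong_dvd_modulus_nat) simp
  then have "[int M = int (2 * n - 1)] (mod 2 * int n)"
    using cong_int_iff[of M "2 * n - 1" "2 * n"] by simp
  moreover have "[int (2 * n - 1) = -1] (mod 2 * int n)"
    using \<open>n > 0\<close> by (simp add: cong_iff_dvd_diff of_nat_diff)
  ultimately have "[int m * (int f)\<^sup>2 = -1] (mod 2 * int n)"
    unfolding decomp by (auto intro: cong_trans)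
  then show ?thesis
    using sum_of_three_squares_criterion[of "int m" "2 * int n"] b \<open>m > 0\<close> \<open>n > 0\<close> by simp
qed

text \<open>As 2n = 2 mod 4, exactly two of three squares with sum 2n are odd, say r^2 and s^2; then
  n = ((r + s) / 2)^2 + ((r - s) / 2)^2 + 2 (t / 2)^2.\<close>

lemma odd_eq_square_plus_square_plus_twice_square:
  fixes n :: int
  assumes "odd n" "n > 0"
  shows "\<exists>x y z. n = x\<^sup>2 + y\<^sup>2 + 2 * z\<^sup>2"
proof -
  have concl: "\<exists>x y z. n = x\<^sup>2 + y\<^sup>2 + 2 * z\<^sup>2"
    if "2 * n = r\<^sup>2 + s\<^sup>2 + t\<^sup>2" "odd r" "odd s" "even t" for r s t
  proof -
    have "even (r + s)" using that by simp
    then obtain x where x: "r + s = 2 * x" by (rule evenE)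
    obtain z where z: "t = 2 * z" using \<open>even t\<close> by (rule evenE)
    have s: "s = 2 * x - r" using x by linarith
    have "2 * n = 2 * (x\<^sup>2 + (r - x)\<^sup>2 + 2 * z\<^sup>2)"
      unfolding that(1) s z by (simp add: algebra_simps power2_eq_square)
    then have "n = x\<^sup>2 + (r - x)\<^sup>2 + 2 * z\<^sup>2" by (simp only: mult_cancel_left) simp
    then show ?thesis by blast
  qed
  obtain r s t where rst: "2 * n = r\<^sup>2 + s\<^sup>2 + t\<^sup>2"
  proof -
    have "odd (nat n)" "int (nat n) = n" using assms by (simp_all add: even_nat_iff)
    then show ?thesis using twice_odd_sum_of_three_squares[of "nat n"] that by metis
  qed
  have "even (r\<^sup>2 + s\<^sup>2 + t\<^sup>2)" using rst by (metis dvd_triv_left)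
  moreover have "\<not> (even r \<and> even s \<and> even t)"
  proof
    assume "even r \<and> even s \<and> even t"
    then have "4 dvd r\<^sup>2 + s\<^sup>2 + t\<^sup>2" by (auto elim!: evenE simp: power_mult_distrib)
    then have "4 dvd 2 * n" using rst by simp
    then show False using assms(1) by presburger
  qed
  ultimately consider "odd r" "odd s" "even t" | "odd r" "odd t" "even s" | "odd s" "odd t" "even r"
    by auto
  then show ?thesis
  proof cases
    case 1
    with rst show ?thesis by (rule concl)
  next
    case 2
    have "2 * n = r\<^sup>2 + t\<^sup>2 + s\<^sup>2" using rst by linarith
    with 2 show ?thesis by (intro concl)
  next
    case 3
    have "2 * n = s\<^sup>2 + t\<^sup>2 + r\<^sup>2" using rst by linarith
    with 3 show ?thesis by (intro concl)
  qed
qed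

section \<open>Polygonal numbers\<close>

definition has_moments :: "int \<Rightarrow> int \<Rightarrow> bool" where
  "has_moments a b \<longleftrightarrow> (\<exists>x1 x2 x3 x4 :: int.
     x1 + x2 + 2 * x3 + 4 * x4 = b \<and> x1\<^sup>2 + x2\<^sup>2 + 2 * x3\<^sup>2 + 4 * x4\<^sup>2 = a)"

text \<open>With \<open>w = x1 + x2 + 2 x3 - 4 x4\<close>, \<open>v = x1 + x2 - 2 x3\<close> and \<open>u = x1 - x2\<close>,
  Cauchy's defect \<open>8a - b\<^sup>2\<close> becomes diagonal.\<close>

lemma has_momentsI:
  assumes "8 * a - b\<^sup>2 = w\<^sup>2 + 2 * v\<^sup>2 + 4 * u\<^sup>2"
    and "8 dvd b - w" "8 dvd b + w - 2 * v" "even (b - u)"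
  shows "has_moments a b"
proof -
  \<comment> \<open>Inverts the change of variables: b - w = 8 x4, b + w - 2 v = 8 x3, and u = x1 -
    x2 has the parity of b.\<close>
  obtain x4 where x4: "b - w = 8 * x4" using assms(2) ..
  obtain y where y: "b + w - 2 * v = 8 * y" using assms(3) ..
  define x3 where "x3 = y"
  have v: "v = b - 4 * x4 - 4 * x3" using x4 y unfolding x3_def by linarith
  have w: "w = b - 8 * x4" using x4 by linarith
  obtain c where c: "b - u = 2 * c" using assms(4) by (rule evenE)
  define x1 where "x1 = b - 2 * x4 - x3 - c"
  define x2 where "x2 = c - 2 * x4 - x3"
  have u: "u = x1 - x2" using c unfolding x1_def x2_def by linarith
  have b: "b = x1 + x2 + 2 * x3 + 4 * x4" unfolding x1_def x2_def by linarith
  have "8 * a = b\<^sup>2 + (w\<^sup>2 + 2 * v\<^sup>2 + 4 * u\<^sup>2)" using assms(1) by linarith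
  also have "\<dots> = 8 * (x1\<^sup>2 + x2\<^sup>2 + 2 * x3\<^sup>2 + 4 * x4\<^sup>2)"
    unfolding v w u b by (simp add: algebra_simps power2_eq_square)
  finally have "a = x1\<^sup>2 + x2\<^sup>2 + 2 * x3\<^sup>2 + 4 * x4\<^sup>2" by simp
  then show ?thesis unfolding has_moments_def using b by metis
qed

lemma odd_eq_odd_even_squares:
  fixes n :: int
  assumes "odd n" "n > 0"
  obtains x y z where "n = x\<^sup>2 + y\<^sup>2 + 2 * z\<^sup>2" "odd x" "even y"
proof -
  obtain x y z where xyz: "n = x\<^sup>2 + y\<^sup>2 + 2 * z\<^sup>2"
    using odd_eq_square_plus_square_plus_twice_square[OF assms] by blast
  have "odd x \<longleftrightarrow> even y" using assms(1) unfolding xyz by simp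
  then show ?thesis
    using xyz that[of x y z] that[of y x z] by (cases "odd x") (simp_all add: add.commute)
qed

text \<open>Modulo 16, unlike modulo 8, odd squares separate the classes +-1 from +-3 modulo
  8.\<close>

lemma odd_square_mod_16:
  fixes x :: int
  assumes "odd x"
  shows "x\<^sup>2 mod 16 = (if x mod 8 = 1 \<or> x mod 8 = 7 then 1 else 9)"
proof -
  define q r where "q = x div 8" and "r = x mod 8"
  have x: "x = 8 * q + r" by (simp add: q_def r_def)
  have "r = 1 \<or> r = 3 \<or> r = 5 \<or> r = 7" using assms unfolding r_def by presburger
  moreover have "x\<^sup>2 = r\<^sup>2 + 16 * (4 * q\<^sup>2 + q * r)"
    unfolding x by (simp add: algebra_simps power2_eq_square)
  then have "x\<^sup>2 mod 16 = r\<^sup>2 mod 16" by (simp only: mod_mult_self2)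
  ultimately show ?thesis unfolding r_def[symmetric] by auto
qed

lemma odd_square_mod_8:
  fixes x :: int
  assumes "odd x"
  shows "x\<^sup>2 mod 8 = 1"
proof -
  have "x\<^sup>2 mod 8 = x\<^sup>2 mod 16 mod 8" by (simp add: mod_mod_cancel)
  then show ?thesis using odd_square_mod_16[OF assms] by auto
qed

text \<open>Write 8a - b^2 = x^2 + 2 z^2 + 4 u^2. Modulo 8 this is 7, so \<open>z\<close> and
  \<open>u\<close> are odd; then \<open>a\<close> odd gives b^2 + x^2 = 2 mod 16, hence x = +-b mod
  8. The signs of \<open>x\<close> and \<open>z\<close> are chosen to meet the congruences.\<close>

lemma has_moments_odd:
  assumes "odd a" "odd b" "b\<^sup>2 < 8 * a"
  shows "has_moments a b"
proof -
  have b8: "b\<^sup>2 mod 8 = 1" using odd_square_mod_8[OF assms(2)] .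
  have "odd (8 * a - b\<^sup>2)" using assms(2) by simp
  then obtain x y z where eq: "8 * a - b\<^sup>2 = x\<^sup>2 + y\<^sup>2 + 2 * z\<^sup>2" "odd x" "even y"
    using odd_eq_odd_even_squares[of "8 * a - b\<^sup>2"] assms(3) by auto
  obtain u where u: "y = 2 * u" using eq(3) by (rule evenE)
  have eq': "8 * a - b\<^sup>2 = x\<^sup>2 + 2 * z\<^sup>2 + 4 * u\<^sup>2" using eq(1) unfolding u by simp
  have x8: "x\<^sup>2 mod 8 = 1" using odd_square_mod_8[OF eq(2)] .
  have "odd z"
  proof
    assume "even z"
    then obtain z' where "z = 2 * z'" by (rule evenE)
    then have "8 * a - b\<^sup>2 = x\<^sup>2 + 8 * z'\<^sup>2 + 4 * u\<^sup>2" using eq' by simp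
    then show False using b8 x8 by presburger
  qed
  then have z8: "z\<^sup>2 mod 8 = 1" by (rule odd_square_mod_8)
  have "odd u"
  proof
    assume "even u"
    then obtain u' where "u = 2 * u'" by (rule evenE)
    then have "8 * a - b\<^sup>2 = x\<^sup>2 + 2 * z\<^sup>2 + 16 * u'\<^sup>2" using eq' by simp
    then show False using b8 x8 z8 by presburger
  qed
  then have u8: "u\<^sup>2 mod 8 = 1" by (rule odd_square_mod_8)
  obtain A where "a = 2 * A + 1" using assms(1) by (rule oddE)
  moreover obtain Z where "z\<^sup>2 = 8 * Z + 1" using z8 mult_div_mod_eq[of 8 "z\<^sup>2"] by metis
  moreover obtain U where "u\<^sup>2 = 8 * U + 1" using u8 mult_div_mod_eq[of 8 "u\<^sup>2"] by metis
  ultimately have "b\<^sup>2 + x\<^sup>2 = 2 + 16 * (A - Z - 2 * U)" using eq' by simp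
  then have "(b\<^sup>2 + x\<^sup>2) mod 16 = 2 mod 16" by (simp only: mod_mult_self2)
  then have "(b\<^sup>2 mod 16 + x\<^sup>2 mod 16) mod 16 = 2" by (simp add: mod_add_eq)
  then have "b mod 8 = 1 \<or> b mod 8 = 7 \<longleftrightarrow> x mod 8 = 1 \<or> x mod 8 = 7"
    unfolding odd_square_mod_16[OF assms(2)] odd_square_mod_16[OF eq(2)]
    by (simp split: if_splits)
  moreover have "b mod 8 = 1 \<or> b mod 8 = 3 \<or> b mod 8 = 5 \<or> b mod 8 = 7" using assms(2) by presburger
  moreover have "x mod 8 = 1 \<or> x mod 8 = 3 \<or> x mod 8 = 5 \<or> x mod 8 = 7" using eq(2) by presburger
  ultimately have "b mod 8 = x mod 8 \<or> (b + x) mod 8 = 0"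
    using mod_add_eq[of b 8 x] by (elim disjE; simp)
  then have "8 dvd b - x \<or> 8 dvd b - (- x)"
    by (auto simp: mod_eq_dvd_iff dvd_eq_mod_eq_0)
  then obtain w where w: "w\<^sup>2 = x\<^sup>2" "8 dvd b - w" by (metis power2_minus)
  obtain c where c: "b - w = 8 * c" using w(2) ..
  have "4 dvd (b - 4 * c) - z \<or> 4 dvd (b - 4 * c) - (- z)"
    using assms(2) \<open>odd z\<close> by presburger
  then obtain v where v: "v\<^sup>2 = z\<^sup>2" "4 dvd (b - 4 * c) - v" by (metis power2_minus)
  have "8 dvd b + w - 2 * v" using c v(2) by presburger
  moreover have "even (b - u)" using assms(2) \<open>odd u\<close> by simp
  ultimately show ?thesis
    using has_momentsI[of a b w v u] eq' w v by simp
qed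

text \<open>The defect is 4 (4 \<alpha> - \<beta>^2), so the representation is scaled by 2. Modulo 4
  the inner factor is 3, which makes \<open>z\<close> odd, as the second congruence
  requires.\<close>

lemma has_moments_2_mod_4:
  assumes "odd \<beta>" "\<beta>\<^sup>2 < 4 * \<alpha>"
  shows "has_moments (2 * \<alpha>) (2 * \<beta>)"
proof -
  have "odd (4 * \<alpha> - \<beta>\<^sup>2)" using assms(1) by simp
  then obtain x y z where eq: "4 * \<alpha> - \<beta>\<^sup>2 = x\<^sup>2 + y\<^sup>2 + 2 * z\<^sup>2" "odd x" "even y"
    using odd_eq_odd_even_squares[of "4 * \<alpha> - \<beta>\<^sup>2"] assms(2) by auto
  obtain y' where y': "y = 2 * y'" using eq(3) by (rule evenE)
  have "odd z"
  proof
    assume "even z"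
    then obtain z' where "z = 2 * z'" by (rule evenE)
    then have "4 * \<alpha> - \<beta>\<^sup>2 = x\<^sup>2 + 4 * y'\<^sup>2 + 8 * z'\<^sup>2" using eq(1) y' by simp
    then show False using odd_square_mod_8[OF assms(1)] odd_square_mod_8[OF eq(2)] by presburger
  qed
  have "4 dvd \<beta> - x \<or> 4 dvd \<beta> - (- x)" using assms(1) eq(2) by presburger
  then obtain w where w: "w\<^sup>2 = x\<^sup>2" "4 dvd \<beta> - w" by (metis power2_minus)
  show ?thesis
  proof (rule has_momentsI[of _ _ "2 * w" "2 * z" y])
    show "8 * (2 * \<alpha>) - (2 * \<beta>)\<^sup>2 = (2 * w)\<^sup>2 + 2 * (2 * z)\<^sup>2 + 4 * y\<^sup>2"
      using eq(1) w(1) by (simp add: power_mult_distrib)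
    show "8 dvd 2 * \<beta> - 2 * w" using w(2) by presburger
    show "8 dvd 2 * \<beta> + 2 * w - 2 * (2 * z)" using w(2) assms(1) \<open>odd z\<close> by presburger
    show "even (2 * \<beta> - y)" using eq(3) by simp
  qed
qed

text \<open>The defect is 16 (\<alpha> - \<gamma>^2); after scaling by 4 the congruences follow from
  \<open>x\<close> and \<open>\<gamma>\<close> being odd.\<close>

lemma has_moments_4_mod_8:
  assumes "odd \<gamma>" "even \<alpha>" "\<gamma>\<^sup>2 < \<alpha>"
  shows "has_moments (2 * \<alpha>) (4 * \<gamma>)"
proof -
  have "odd (\<alpha> - \<gamma>\<^sup>2)" using assms by simp
  then obtain x y z where eq: "\<alpha> - \<gamma>\<^sup>2 = x\<^sup>2 + y\<^sup>2 + 2 * z\<^sup>2" "odd x" "even y"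
    using odd_eq_odd_even_squares[of "\<alpha> - \<gamma>\<^sup>2"] assms(3) by auto
  show ?thesis
  proof (rule has_momentsI[of _ _ "4 * x" "4 * z" "2 * y"])
    show "8 * (2 * \<alpha>) - (4 * \<gamma>)\<^sup>2 = (4 * x)\<^sup>2 + 2 * (4 * z)\<^sup>2 + 4 * (2 * y)\<^sup>2"
      using eq(1) by (simp add: power_mult_distrib)
    show "8 dvd 4 * \<gamma> - 4 * x" using assms(1) eq(2) by presburger
    show "8 dvd 4 * \<gamma> + 4 * x - 2 * (4 * z)" using assms(1) eq(2) by presburger
  qed simp
qed

text \<open>The defect is 64 n; after scaling by 8 the congruences hold automatically.\<close>

lemma has_moments_0_mod_8:
  assumes "\<alpha> - (2 * \<delta>)\<^sup>2 = 4 * n" "odd n" "n > 0"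
  shows "has_moments (2 * \<alpha>) (8 * \<delta>)"
proof -
  obtain x y z where eq: "n = x\<^sup>2 + y\<^sup>2 + 2 * z\<^sup>2"
    using odd_eq_square_plus_square_plus_twice_square[OF assms(2,3)] by blast
  show ?thesis
  proof (rule has_momentsI[of _ _ "8 * x" "8 * z" "4 * y"])
    show "8 * (2 * \<alpha>) - (8 * \<delta>)\<^sup>2 = (8 * x)\<^sup>2 + 2 * (8 * z)\<^sup>2 + 4 * (4 * y)\<^sup>2"
      using assms(1) unfolding eq by (simp add: power_mult_distrib)
  qed auto
qed

text \<open>Cauchy--Schwarz applied to the three variables other than the one assumed negative.\<close>

lemma moments_nonneg:
  fixes x1 x2 x3 x4 :: int
  assumes b: "x1 + x2 + 2 * x3 + 4 * x4 = b" and a: "x1\<^sup>2 + x2\<^sup>2 + 2 * x3\<^sup>2 + 4 * x4\<^sup>2 = a"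
    and "b \<ge> 0" "7 * a < b\<^sup>2 + 2 * b + 8"
  shows "x1 \<ge> 0 \<and> x2 \<ge> 0 \<and> x3 \<ge> 0 \<and> x4 \<ge> 0"
proof -
  have "a \<ge> 0" unfolding a[symmetric] by simp
  have neg: "- (b * x) \<ge> b \<and> x\<^sup>2 \<ge> 1" if "x < 0" for x
  proof -
    have "b * 1 \<le> b * (- x)" using that \<open>b \<ge> 0\<close> by (intro mult_left_mono) auto
    moreover have "x * x > 0" using that by (simp add: mult_neg_neg)
    ultimately show ?thesis by (simp add: power2_eq_square)
  qed
  have outer: "x \<ge> 0" if "x + y + 2 * x3 + 4 * x4 = b" "x\<^sup>2 + y\<^sup>2 + 2 * x3\<^sup>2 + 4 * x4\<^sup>2 = a" for x y
  proof (rule ccontr)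
    assume "\<not> x \<ge> 0"
    then have n: "- (b * x) \<ge> b" "x\<^sup>2 \<ge> 1" using neg[of x] by auto
    \<comment> \<open>Lagrange's identity with 7 = 1 + 2 + 4, the total weight of the other
      variables; x <= -1 then gives 7a >= (b + 1)^2 + 7. The factors 6 and 4 below arise in the same
      way.\<close>
    have "7 * a = (b - x)\<^sup>2 + 7 * x\<^sup>2 + (2 * (y - x3)\<^sup>2 + 4 * (y - x4)\<^sup>2 + 8 * (x3 - x4)\<^sup>2)"
      unfolding that[symmetric] by (simp add: algebra_simps power2_eq_square)
    moreover have "(b - x)\<^sup>2 = b\<^sup>2 - 2 * (b * x) + x\<^sup>2" by (simp add: algebra_simps power2_eq_square)
    moreover have "0 \<le> 2 * (y - x3)\<^sup>2 + 4 * (y - x4)\<^sup>2 + 8 * (x3 - x4)\<^sup>2" by simp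
    ultimately show False using n assms(4) by linarith
  qed
  have "x3 \<ge> 0"
  proof (rule ccontr)
    assume "\<not> x3 \<ge> 0"
    then have n: "- (b * x3) \<ge> b" "x3\<^sup>2 \<ge> 1" using neg[of x3] by auto
    have "6 * a = (b - 2 * x3)\<^sup>2 + 12 * x3\<^sup>2 + ((x1 - x2)\<^sup>2 + 4 * (x1 - x4)\<^sup>2 + 4 * (x2 - x4)\<^sup>2)"
      unfolding a[symmetric] b[symmetric] by (simp add: algebra_simps power2_eq_square)
    moreover have "(b - 2 * x3)\<^sup>2 = b\<^sup>2 - 4 * (b * x3) + 4 * x3\<^sup>2"
      by (simp add: algebra_simps power2_eq_square)
    moreover have "0 \<le> (x1 - x2)\<^sup>2 + 4 * (x1 - x4)\<^sup>2 + 4 * (x2 - x4)\<^sup>2" by simp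
    ultimately show False using n assms(3,4) \<open>a \<ge> 0\<close> by linarith
  qed
  moreover have "x4 \<ge> 0"
  proof (rule ccontr)
    assume "\<not> x4 \<ge> 0"
    then have n: "- (b * x4) \<ge> b" "x4\<^sup>2 \<ge> 1" using neg[of x4] by auto
    have "4 * a = (b - 4 * x4)\<^sup>2 + 16 * x4\<^sup>2 + ((x1 - x2)\<^sup>2 + 2 * (x1 - x3)\<^sup>2 + 2 * (x2 - x3)\<^sup>2)"
      unfolding a[symmetric] b[symmetric] by (simp add: algebra_simps power2_eq_square)
    moreover have "(b - 4 * x4)\<^sup>2 = b\<^sup>2 - 8 * (b * x4) + 16 * x4\<^sup>2"
      by (simp add: algebra_simps power2_eq_square)
    moreover have "0 \<le> (x1 - x2)\<^sup>2 + 2 * (x1 - x3)\<^sup>2 + 2 * (x2 - x3)\<^sup>2" by simp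
    ultimately show False using n assms(3,4) \<open>a \<ge> 0\<close> by linarith
  qed
  ultimately show ?thesis using outer[of x1 x2] outer[of x2 x1] a b by (simp add: add_ac)
qed

text \<open>For \<open>b = N - mk\<close> and \<open>a = b + 2k\<close> the two bounds are \<open>b\<^sup>2 < 8a\<close> and
  \<open>7a < b\<^sup>2 + 2b + 8\<close>; they leave room for every residue of \<open>k\<close> modulo 8.\<close>

lemma exists_multiplier_in_window:
  fixes m N \<rho> :: int
  assumes m: "m \<ge> 3" and N: "N \<ge> 1056 * m ^ 3" and \<rho>: "0 \<le> \<rho>" "\<rho> < 8"
  shows "\<exists>k b. k mod 8 = \<rho> \<and> b = N - m * k \<and> b \<ge> 0 \<and> b\<^sup>2 < 8 * b + 16 * k \<and> 5 * b + 14 * k < b\<^sup>2 + 8"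
proof -
  define K where "K j = \<rho> + 8 * int j" for j
  define B where "B j = N - m * K j" for j
  define Q where "Q j \<longleftrightarrow> (B j)\<^sup>2 < 8 * B j + 16 * K j" for j
  have m3: "m ^ 3 = m * m\<^sup>2" by (simp add: power3_eq_cube power2_eq_square)
  have m2: "m\<^sup>2 \<ge> 9" using power_mono[OF m, of 2] by simp
  \<comment> \<open>The last index with m K <= N, so that 0 <= B < 8 m there and \<open>Q\<close>
    holds with ample room.\<close>
  define J where "J = nat ((N div m - \<rho>) div 8)"
  have "m * (1056 * m\<^sup>2) \<le> N" using N m3 by simp
  then have Nm: "1056 * m\<^sup>2 \<le> N div m"
    using zdiv_mono1[of "m * (1056 * m\<^sup>2)" N m] m by simp
  have KJ: "N div m - 7 \<le> K J" "K J \<le> N div m"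
  proof -
    have "(N div m - \<rho>) div 8 \<ge> 0" using Nm m2 \<rho> by simp
    then have "K J = \<rho> + 8 * ((N div m - \<rho>) div 8)" unfolding K_def J_def by simp
    moreover have "8 * ((N div m - \<rho>) div 8) + (N div m - \<rho>) mod 8 = N div m - \<rho>" by simp
    moreover have "0 \<le> (N div m - \<rho>) mod 8" "(N div m - \<rho>) mod 8 < 8" by simp_all
    ultimately show "N div m - 7 \<le> K J" "K J \<le> N div m" by linarith+
  qed
  have BJ: "B J \<ge> 0" "B J < 8 * m"
  proof -
    have "m * K J \<le> m * (N div m)" "m * (N div m - 7) \<le> m * K J"
      using KJ m by (auto intro!: mult_left_mono)
    moreover have "N = m * (N div m) + N mod m" "0 \<le> N mod m" "N mod m < m" using m by auto
    ultimately show "B J \<ge> 0" "B J < 8 * m"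
      unfolding B_def right_diff_distrib by linarith+
  qed
  have "Q J"
  proof -
    have "(B J)\<^sup>2 \<le> (8 * m)\<^sup>2" using BJ by (intro power_mono) auto
    then show ?thesis unfolding Q_def using BJ KJ Nm m2 by (simp add: power_mult_distrib)
  qed
  \<comment> \<open>At the least index satisfying \<open>Q\<close>, its failure one step earlier
    bounds \<open>k\<close> above in terms of \<open>b\<close>, which yields the second
    inequality.\<close>
  define j where "j = (LEAST j. Q j)"
  have "Q j" unfolding j_def using \<open>Q J\<close> by (rule LeastI)
  have "j \<le> J" unfolding j_def using \<open>Q J\<close> by (rule Least_le)
  have "\<not> Q 0"
  proof
    assume "Q 0"
    have "K 0 \<le> 7" "K 0 \<ge> 0" using \<rho> by (auto simp: K_def)
    have "m * K 0 \<le> m * 7" using \<open>K 0 \<le> 7\<close> m by (intro mult_left_mono) auto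
    moreover have "m * 9 \<le> m * m\<^sup>2" using m2 m by (intro mult_left_mono) auto
    ultimately have "B 0 \<ge> 1000" unfolding B_def using N m m3 by linarith
    then have "1000 * B 0 \<le> (B 0)\<^sup>2" unfolding power2_eq_square by (intro mult_right_mono) auto
    then show False using \<open>Q 0\<close> \<open>B 0 \<ge> 1000\<close> \<open>K 0 \<le> 7\<close> unfolding Q_def by linarith
  qed
  then obtain i where i: "j = Suc i" using \<open>Q j\<close> by (cases j) auto
  have "\<not> Q i" using i not_less_Least[of i Q] unfolding j_def by simp
  define k b where "k = K j" and "b = B j"
  have bk: "b = N - m * k" by (simp add: b_def k_def B_def)
  have "K i = k - 8" "B i = b + 8 * m"
    by (simp_all add: k_def b_def B_def K_def i algebra_simps)
  then have fail: "16 * k \<le> (b + 8 * m)\<^sup>2 - 8 * b - 64 * m + 128"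
    using \<open>\<not> Q i\<close> by (simp add: Q_def not_less)
  have "m * K j \<le> m * K J" using \<open>j \<le> J\<close> m by (intro mult_left_mono) (auto simp: K_def)
  then have "b \<ge> 0" using BJ(1) by (simp add: b_def B_def)
  \<comment> \<open>The second inequality comes down to b^2 / 8 beating 14 m b + 56 m^2, and b >=
    116 m suffices. A smaller \<open>b\<close> would give 16 k below about 124^2 m^2 = 15376 m^2,
    whereas N >= 1056 m^3 forces about 16896 m^2.\<close>
  have "b \<ge> 116 * m"
  proof (rule ccontr)
    assume "\<not> b \<ge> 116 * m"
    then have "(b + 8 * m)\<^sup>2 \<le> (124 * m)\<^sup>2" using \<open>b \<ge> 0\<close> m by (intro power_mono) auto
    then have "(b + 8 * m)\<^sup>2 \<le> 15376 * m\<^sup>2" by (simp add: power_mult_distrib)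
    moreover have "m * (1056 * m\<^sup>2 - 116) < m * k"
      using N m3 bk \<open>\<not> b \<ge> 116 * m\<close> by (simp add: algebra_simps)
    then have "1056 * m\<^sup>2 - 116 < k" using m by simp
    ultimately show False using fail m2 m \<open>b \<ge> 0\<close> by linarith
  qed
  have "(116 * m) * b \<le> b\<^sup>2"
    unfolding power2_eq_square using \<open>b \<ge> 116 * m\<close> \<open>b \<ge> 0\<close> by (intro mult_right_mono)
  moreover have "m * (116 * m) \<le> m * b" using \<open>b \<ge> 116 * m\<close> m by (intro mult_left_mono) auto
  then have "116 * m\<^sup>2 \<le> m * b" by (simp add: power2_eq_square)
  moreover have "(b + 8 * m)\<^sup>2 = b\<^sup>2 + 16 * (m * b) + 64 * m\<^sup>2"
    by (simp add: algebra_simps power2_eq_square)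
  ultimately have "5 * b + 14 * k < b\<^sup>2 + 8"
    using fail m m2 \<open>b \<ge> 116 * m\<close> by (simp add: mult.assoc)
  moreover have "b\<^sup>2 < 8 * b + 16 * k" using \<open>Q j\<close> by (simp add: Q_def k_def b_def)
  moreover have "k mod 8 = \<rho>" using \<rho> by (simp add: k_def K_def)
  ultimately show ?thesis using bk \<open>b \<ge> 0\<close> by blast
qed

text \<open>The residue of \<open>k\<close> modulo 8 steers b = N - m k into one of the four classes
  treated above: odd if \<open>m\<close> or \<open>N\<close> is odd, otherwise 2 mod 4 unless 4
  divides both \<open>m\<close> and \<open>N\<close>, when N mod 8 decides.\<close>

lemma exists_multiplier_has_moments:
  fixes m N :: int
  assumes "m \<ge> 3" "N \<ge> 1056 * m ^ 3"
  shows "\<exists>k b. b = N - m * k \<and> b \<ge> 0 \<and> has_moments (b + 2 * k) b \<and> 5 * b + 14 * k < b\<^sup>2 + 8"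
proof -
  have main: ?thesis
    if \<rho>: "0 \<le> \<rho>" "\<rho> < 8"
      and rep: "\<And>k b. k mod 8 = \<rho> \<Longrightarrow> b = N - m * k \<Longrightarrow> b\<^sup>2 < 8 * (b + 2 * k) \<Longrightarrow> has_moments (b + 2 * k) b" for \<rho>
  proof -
    obtain k b where kb: "k mod 8 = \<rho>" "b = N - m * k" "b \<ge> 0" "b\<^sup>2 < 8 * b + 16 * k" "5 * b + 14 * k < b\<^sup>2 + 8"
      using exists_multiplier_in_window[OF assms \<rho>] by blast
    then have "has_moments (b + 2 * k) b" by (intro rep) auto
    then show ?thesis using kb by blast
  qed
  have two_mod_four: "has_moments (b + 2 * k) b" if "b mod 4 = 2" "b\<^sup>2 < 8 * (b + 2 * k)" for b k
  proof -
    define \<beta> where "\<beta> = b div 2"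
    have b: "b = 2 * \<beta>" "odd \<beta>" using that(1) unfolding \<beta>_def by presburger+
    have "\<beta>\<^sup>2 < 4 * (\<beta> + k)" using that(2) unfolding b(1) by (simp add: power_mult_distrib)
    then have "has_moments (2 * (\<beta> + k)) (2 * \<beta>)" by (rule has_moments_2_mod_4[OF b(2)])
    then show ?thesis by (simp add: b(1))
  qed
  have "odd m \<or> even m \<and> odd N \<or> m mod 4 = 2 \<and> even N \<or> m mod 4 = 0 \<and> N mod 4 = 2
      \<or> m mod 4 = 0 \<and> N mod 4 = 0" by presburger
  then consider "odd m" | "even m" "odd N" | "m mod 4 = 2" "even N" | "m mod 4 = 0" "N mod 4 = 2"
    | "m mod 4 = 0" "N mod 4 = 0" by blast
  then show ?thesis
  proof cases
    case 1
    show ?thesis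
    proof (rule main[of "if even N then 1 else 0"])
      fix k b assume k: "k mod 8 = (if even N then 1 else 0)" "b = N - m * k" "b\<^sup>2 < 8 * (b + 2 * k)"
      have "odd k \<longleftrightarrow> even N" using k(1) by (cases "even N"; simp; presburger)
      then have "odd b" using k(2) 1 by auto
      then show "has_moments (b + 2 * k) b" using k(3) by (intro has_moments_odd) auto
    qed auto
  next
    case 2
    show ?thesis
    proof (rule main[of 0])
      fix k b assume k: "k mod 8 = 0" "b = N - m * k" "b\<^sup>2 < 8 * (b + 2 * k)"
      have "odd b" using k(2) 2 by auto
      then show "has_moments (b + 2 * k) b" using k(3) by (intro has_moments_odd) auto
    qed auto
  next
    case 3
    define m' where "m' = m div 4"
    have m: "m = 4 * m' + 2" using 3(1) unfolding m'_def by presburger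
    show ?thesis
    \<comment> \<open>Here m k = 2 k mod 4, so the parity of \<open>k\<close> decides whether b = N
      or b = N + 2 mod 4.\<close>
    proof (rule main[of "if N mod 4 = 2 then 0 else 1"])
      fix k b assume k: "k mod 8 = (if N mod 4 = 2 then 0 else 1)" "b = N - m * k" "b\<^sup>2 < 8 * (b + 2 * k)"
      have "b = N - 2 * k - 4 * (m' * k)" using k(2) m by (simp add: algebra_simps)
      moreover have "(N - 2 * k) mod 4 = 2"
      proof (cases "N mod 4 = 2")
        case True
        then show ?thesis using k(1) by (simp; presburger)
      next
        case False
        then show ?thesis using k(1) 3(2) by (simp; presburger)
      qed
      ultimately have "b mod 4 = 2" by presburger
      then show "has_moments (b + 2 * k) b" using k(3) by (rule two_mod_four)
    qed auto
  next
    case 4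
    define m' where "m' = m div 4"
    have m: "m = 4 * m'" using 4(1) unfolding m'_def by presburger
    show ?thesis
    proof (rule main[of 0])
      fix k b assume k: "k mod 8 = 0" "b = N - m * k" "b\<^sup>2 < 8 * (b + 2 * k)"
      have "b = N - 4 * (m' * k)" using k(2) m by simp
      then have "b mod 4 = 2" using 4(2) by presburger
      then show "has_moments (b + 2 * k) b" using k(3) by (rule two_mod_four)
    qed auto
  next
    case 5
    define m' N' where "m' = m div 4" and "N' = N div 4"
    have mN: "m = 4 * m'" "N = 4 * N'" using 5 unfolding m'_def N'_def by presburger+
    show ?thesis
    proof (cases "odd N'")
      case True
      show ?thesis
      proof (rule main[of 0])
        fix k b assume k: "k mod 8 = 0" "b = N - m * k" "b\<^sup>2 < 8 * (b + 2 * k)"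
        define i where "i = k div 8"
        have i: "k = 8 * i" using k(1) unfolding i_def by presburger
        define \<gamma> where "\<gamma> = N' - 8 * (m' * i)"
        have b: "b = 4 * \<gamma>" using k(2) mN i by (simp add: \<gamma>_def algebra_simps)
        have "\<gamma>\<^sup>2 < 2 * \<gamma> + 8 * i" using k(3) unfolding b i by (simp add: power_mult_distrib)
        then have "has_moments (2 * (2 * \<gamma> + 8 * i)) (4 * \<gamma>)"
          using True by (intro has_moments_4_mod_8) (simp_all add: \<gamma>_def)
        then show "has_moments (b + 2 * k) b" by (simp add: b i)
      qed auto
    next
      case False
      then obtain N'' where N'': "N' = 2 * N''" by auto
      show ?thesis
      \<comment> \<open>With k = 4 mod 8 the reduced defect n = \<delta> - \<delta>^2 + 2 i + 1 is
        odd, since \<delta> - \<delta>^2 is even.\<close>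
      proof (rule main[of 4])
        fix k b assume k: "k mod 8 = 4" "b = N - m * k" "b\<^sup>2 < 8 * (b + 2 * k)"
        define i where "i = k div 8"
        have i: "k = 8 * i + 4" using k(1) unfolding i_def by presburger
        define \<delta> where "\<delta> = N'' - m' * (4 * i + 2)"
        define n where "n = \<delta> - \<delta>\<^sup>2 + 2 * i + 1"
        have b: "b = 8 * \<delta>" using k(2) mN i N'' by (simp add: \<delta>_def algebra_simps)
        have "odd n" unfolding n_def by simp
        moreover have "n > 0" using k(3) unfolding b i n_def by (simp add: power_mult_distrib)
        moreover have "(4 * \<delta> + 8 * i + 4) - (2 * \<delta>)\<^sup>2 = 4 * n"
          by (simp add: n_def power_mult_distrib)
        ultimately have "has_moments (2 * (4 * \<delta> + 8 * i + 4)) (8 * \<delta>)"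
          by (intro has_moments_0_mod_8)
        then show "has_moments (b + 2 * k) b" by (simp add: b i add.assoc)
      qed auto
    qed
  qed
qed

lemma twice_polygonal: "2 * polygonal (m + 2) x = m * (x\<^sup>2 - x) + 2 * x"
proof -
  have "2 * (x * (x - 1) div 2) = x * (x - 1)" by (rule dvd_mult_div_cancel) auto
  then have "m * (2 * (x * (x - 1) div 2)) = m * (x\<^sup>2 - x)"
    by (simp add: algebra_simps power2_eq_square)
  then show ?thesis by (simp add: polygonal_def)
qed

theorem theorem1p4:
  fixes m N :: int
  assumes "m \<ge> 3"
    and "N \<ge> 1056 * m ^ 3"
  shows "\<exists>x1 x2 x3 x4 :: nat.
    N = polygonal (m + 2) (int x1) + polygonal (m + 2) (int x2)
      + 2 * polygonal (m + 2) (int x3) + 4 * polygonal (m + 2) (int x4)"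
proof -
  obtain k b where kb: "b = N - m * k" "b \<ge> 0" "has_moments (b + 2 * k) b" "5 * b + 14 * k < b\<^sup>2 + 8"
    using exists_multiplier_has_moments[OF assms] by blast
  obtain x1 x2 x3 x4 where x: "x1 + x2 + 2 * x3 + 4 * x4 = b"
    "x1\<^sup>2 + x2\<^sup>2 + 2 * x3\<^sup>2 + 4 * x4\<^sup>2 = b + 2 * k"
    using kb(3) unfolding has_moments_def by blast
  \<comment> \<open>For a = b + 2 k the inequality on \<open>k\<close> and \<open>b\<close> reads 7a
    < b^2 + 2b + 8.\<close>
  have nonneg: "x1 \<ge> 0 \<and> x2 \<ge> 0 \<and> x3 \<ge> 0 \<and> x4 \<ge> 0"
    using moments_nonneg[OF x kb(2)] kb(4) by simp
  let ?p = "polygonal (m + 2)"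
  have "2 * (?p x1 + ?p x2 + 2 * ?p x3 + 4 * ?p x4)
      = 2 * ?p x1 + 2 * ?p x2 + 2 * (2 * ?p x3) + 4 * (2 * ?p x4)" by simp
  also have "\<dots> = m * ((x1\<^sup>2 + x2\<^sup>2 + 2 * x3\<^sup>2 + 4 * x4\<^sup>2) - (x1 + x2 + 2 * x3 + 4 * x4))
      + 2 * (x1 + x2 + 2 * x3 + 4 * x4)"
    unfolding twice_polygonal by (simp add: algebra_simps)
  also have "\<dots> = 2 * N" unfolding x using kb(1) by simp
  finally have "N = ?p x1 + ?p x2 + 2 * ?p x3 + 4 * ?p x4" by simp
  then show ?thesis
    using nonneg by (intro exI[of _ "nat x1"] exI[of _ "nat x2"] exI[of _ "nat x3"] exI[of _ "nat x4"]) simp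
qed

end
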